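(* Let $c>0$ and $k,m\in\mathbb{N}$. Denote the even and odd Clifford prolate spheroidal wave functions by $$\psi^{(k,c)}_{2N,m}(x)=P^{k,c}_{N,m}(|x|^2)\,Y_k(x),\qquad \psi^{(k,c)}_{2N+1,m}(x)=Q^{k,c}_{N,m}(|x|^2)\,x\,Y_k(x),$$ where $Y_k$ is a (nonzero) spherical monogenic of degree $k$, and let $\mu^{(k,c)}_{2N,m}$, $\mu^{(k,c)}_{2N+1,m}$ be the corresponding eigenvalues of the finite Fourier transform $\mathcal{G}_c$. Then: (i) (Even case) the function $$\varphi^{(k+\frac m2-1)}_N(r)=r^{\,k+\frac{m-1}{2}}\,P^{k,c}_{N,m}(r^2),\qquad 0<r<1,$$ is an eigenfunction of the finite Hankel transform $\mathcal{H}_c^{(k+\frac m2-1)}$, with eigenvalue $$\gamma^{(k+\frac m2-1)}_N=(-i)^k\,c^{\frac{m-1}{2}}\,\mu^{(k,c)}_{2N,m}.$$ (ii) (Odd case) the function $$\varphi^{(k+\frac m2)}_N(r)=r^{\,k+\frac{m+1}{2}}\,Q^{k,c}_{N,m}(r^2),\qquad 0<r<1,$$ is an eigenfunction of the finite Hankel transform $\mathcal{H}_c^{(k+\frac m2)}$, with eigenvalue $$\gamma^{(k+\frac m2)}_N=(-i)^{k+1}\,c^{\frac{m-1}{2}}\,\mu^{(k,c)}_{2N+1,m}.$$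
   Context: $\mathbb{R}_m$ is the real Clifford algebra generated by $e_1,\dots,e_m$ with $e_j^2=-1$, $e_ie_j=-e_je_i$ for $i\neq j$; $\mathbb{C}_m$ is its complexification. A point $(x_1,\dots,x_m)\in\mathbb{R}^m$ is identified with the Clifford vector $x=\sum_je_jx_j$, and $xY_k(x)$ is a Clifford product. The Dirac operator is $\partial_x=\sum_je_j\partial_{x_j}$ (acting from the left). A spherical monogenic of degree $k$ is a $\mathbb{C}_m$-valued homogeneous polynomial $Y_k$ of degree $k$ on $\mathbb{R}^m$ with $\partial_xY_k=0$. For $c>0$ the Clifford prolate spheroidal wave functions (CPSWFs) are the eigenfunctions of the operator $L_cf(x)=\partial_x((1-|x|^2)\partial_xf(x))+4\pi^2c^2|x|^2f(x)$ on the closed unit ball $B(1)\subset\mathbb{R}^m$; equivalently they are eigenfunctions of the finite Fourier transform $\mathcal{G}_c$, and $\mu^{(k,c)}_{n,m}$ denotes the eigenvalue in $$\mathcal{G}_c\psi^{(k,c)}_{n,m}(x)=\int_{B(1)}\psi^{(k,c)}_{n,m}(y)\,e^{2\pi ic\langle x,y\rangle}\,dy=\mu^{(k,c)}_{n,m}\,\psi^{(k,c)}_{n,m}(x),$$ where $\langle x,y\rangle=\sum_jx_jy_j$ in the exponential. The radial factors $P^{k,c}_{N,m},Q^{k,c}_{N,m}$ are scalar-valued functions on $[0,1]$. The finite Hankel transform of order $\alpha$ is $$\mathcal{H}^{(\alpha)}_cf(x)=\sqrt{2\pi}\int_0^1\sqrt{2\pi cxy}\,J_\alpha(2\pi cxy)\,f(y)\,dy,\qquad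 0<x<1,$$ with $J_\alpha$ the Bessel function of the first kind. Its eigenfunctions are denoted $\varphi^{(\alpha)}_N$ and the associated eigenvalues $\gamma^{(\alpha)}_N$, i.e. $\mathcal{H}^{(\alpha)}_c\varphi^{(\alpha)}_N=\gamma^{(\alpha)}_N\varphi^{(\alpha)}_N$; no further normalization or ordering of these eigenfunctions is prescribed, so the index $N$ of the Hankel eigenpair is the one inherited from the CPSWF. *)

theory Defs
  imports "HOL-Analysis.Analysis"
begin

section \<open>The complex Clifford algebra\<close>

text \<open>
  The index type \<open>'n\<close> has \<open>m = CARD('n)\<close> elements. The complexified Clifford algebra has
  the basis of blades \<open>e\<^sub>A = e\<^bsub>a1\<^esub> \<dots> e\<^bsub>ar\<^esub>\<close>, where \<open>A = {a1 < \<dots> < ar}\<close>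
  ranges over all subsets of \<open>'n\<close>; the linear order on \<open>'n\<close> only serves to fix the sign of each
  blade. An element is stored as its family of coordinates. The componentwise product that the
  library puts on this type is not the Clifford product.
\<close>

type_synonym 'n clifford = "complex ^ ('n set)"

text \<open>
  Sorting the word \<open>e\<^sub>A e\<^sub>B\<close> gives a sign \<open>-1\<close> for each pair
  \<open>a \<in> A\<close>, \<open>b \<in> B\<close> with \<open>b < a\<close> (anticommutation) and for each pair with
  \<open>b = a\<close> (since \<open>e\<^sub>a\<^sup>2 = -1\<close>); the surviving generators are those of the symmetric
  difference.
\<close>

definition blade_sign :: "('n::{finite,linorder}) set \<Rightarrow> 'n set \<Rightarrow> complex" where
  "blade_sign A B = (\<Prod>a\<in>A. \<Prod>b\<in>B. if b \<le> a then -1 else 1)"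

definition blade :: "('n::{finite,linorder}) set \<Rightarrow> 'n clifford" where
  "blade A = axis A 1"

definition cliff_mult ::
    "('n::{finite,linorder}) clifford \<Rightarrow> 'n clifford \<Rightarrow> 'n clifford" (infixl "\<odot>" 70) where
  "u \<odot> v = (\<Sum>A\<in>UNIV. \<Sum>B\<in>UNIV.
      (blade_sign A B * (u $ A) * (v $ B)) *s blade ((A - B) \<union> (B - A)))"

definition gen :: "'n::{finite,linorder} \<Rightarrow> 'n clifford" where
  "gen j = blade {j}"

definition cliff_vec :: "real ^ 'n::{finite,linorder} \<Rightarrow> 'n clifford" where
  "cliff_vec x = (\<Sum>j\<in>UNIV. (x $ j) *\<^sub>R gen j)"


subsection \<open>Sanity checks: the Clifford algebra laws\<close>

lemma cliff_mult_add_left: "(u + v) \<odot> w = u \<odot> w + v \<odot> w"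
  by (simp add: cliff_mult_def vec_eq_iff sum.distrib algebra_simps)

lemma cliff_mult_add_right: "u \<odot> (v + w) = u \<odot> v + u \<odot> w"
  by (simp add: cliff_mult_def vec_eq_iff sum.distrib algebra_simps)

lemma cliff_mult_scale_left: "(c *s u) \<odot> v = c *s (u \<odot> v)"
  by (simp add: cliff_mult_def vec_eq_iff sum_distrib_left mult_ac)

lemma cliff_mult_scale_right: "u \<odot> (c *s v) = c *s (u \<odot> v)"
  by (simp add: cliff_mult_def vec_eq_iff sum_distrib_left mult_ac)

lemma cliff_mult_zero_left [simp]: "0 \<odot> v = 0"
  by (simp add: cliff_mult_def)

lemma cliff_mult_zero_right [simp]: "v \<odot> 0 = 0"
  by (simp add: cliff_mult_def)

lemma cliff_mult_sum_left: "(\<Sum>i\<in>I. f i) \<odot> v = (\<Sum>i\<in>I. f i \<odot> v)"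
  by (induction I rule: infinite_finite_induct) (simp_all add: cliff_mult_add_left)

lemma cliff_mult_sum_right: "v \<odot> (\<Sum>i\<in>I. f i) = (\<Sum>i\<in>I. v \<odot> f i)"
  by (induction I rule: infinite_finite_induct) (simp_all add: cliff_mult_add_right)

lemma blade_mult: "blade A \<odot> blade B = blade_sign A B *s blade ((A - B) \<union> (B - A))"
proof -
  have "blade A \<odot> blade B = (\<Sum>A'\<in>UNIV. \<Sum>B'\<in>UNIV. if A' = A then
      (if B' = B then blade_sign A B *s blade ((A - B) \<union> (B - A)) else 0) else 0)"
    unfolding cliff_mult_def by (intro sum.cong refl) (auto simp: blade_def axis_def)
  also have "\<dots> = blade_sign A B *s blade ((A - B) \<union> (B - A))"
    by (subst sum.swap) simp
  finally show ?thesis .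
qed

lemma blade_expand: "u = (\<Sum>A\<in>UNIV. (u $ A) *s blade A)"
  by (simp add: vec_eq_iff blade_def axis_def if_distrib cong: if_cong)

lemma gen_square: "gen j \<odot> gen j = - blade {}"
  by (simp add: gen_def blade_mult blade_sign_def vec_eq_iff)

lemma gen_anticommute: "i \<noteq> j \<Longrightarrow> gen i \<odot> gen j = - (gen j \<odot> gen i)"
  by (auto simp: gen_def blade_mult blade_sign_def vec_eq_iff insert_Diff_if Un_commute)

lemma cliff_one_left: "blade {} \<odot> u = u"
  by (subst (1 2) blade_expand)
     (simp add: cliff_mult_sum_right cliff_mult_scale_right blade_mult blade_sign_def)

lemma cliff_one_right: "u \<odot> blade {} = u"
  by (subst (1 2) blade_expand)
     (simp add: cliff_mult_sum_left cliff_mult_scale_left blade_mult blade_sign_def)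

lemma prod_symdiff:
  fixes f :: "'a::finite \<Rightarrow> complex"
  assumes "\<And>x. f x * f x = 1"
  shows "(\<Prod>x\<in>(A - B) \<union> (B - A). f x) = (\<Prod>x\<in>A. f x) * (\<Prod>x\<in>B. f x)"
proof -
  have sq: "(\<Prod>x\<in>C. f x) * (\<Prod>x\<in>C. f x) = 1" for C
    by (simp add: assms flip: prod.distrib)
  have A: "(\<Prod>x\<in>A. f x) = (\<Prod>x\<in>A - B. f x) * (\<Prod>x\<in>A \<inter> B. f x)"
    by (subst prod.union_disjoint [symmetric]) (auto intro!: prod.cong)
  have B: "(\<Prod>x\<in>B. f x) = (\<Prod>x\<in>B - A. f x) * (\<Prod>x\<in>A \<inter> B. f x)"
    by (subst prod.union_disjoint [symmetric]) (auto intro!: prod.cong)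
  have "(\<Prod>x\<in>(A - B) \<union> (B - A). f x) = (\<Prod>x\<in>A - B. f x) * (\<Prod>x\<in>B - A. f x)"
    by (rule prod.union_disjoint) auto
  also have "\<dots> = (\<Prod>x\<in>A - B. f x) * (\<Prod>x\<in>B - A. f x)
      * ((\<Prod>x\<in>A \<inter> B. f x) * (\<Prod>x\<in>A \<inter> B. f x))"
    by (simp only: sq mult_1_right)
  finally show ?thesis
    by (simp add: A B mult_ac)
qed

lemma blade_sign_symdiff_left:
  "blade_sign ((A - B) \<union> (B - A)) C = blade_sign A C * blade_sign B C"
  unfolding blade_sign_def
  by (rule prod_symdiff) (auto simp flip: prod.distrib intro!: prod.neutral)

lemma blade_sign_symdiff_right:
  "blade_sign C ((A - B) \<union> (B - A)) = blade_sign C A * blade_sign C B"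
  unfolding blade_sign_def by (subst prod_symdiff) (simp_all add: prod.distrib)

lemma blade_mult_assoc: "blade A \<odot> blade B \<odot> blade C = blade A \<odot> (blade B \<odot> blade C)"
proof -
  have "((A - B) \<union> (B - A) - C) \<union> (C - ((A - B) \<union> (B - A)))
      = (A - ((B - C) \<union> (C - B))) \<union> ((B - C) \<union> (C - B) - A)"
    by blast
  then show ?thesis
    by (simp add: blade_mult cliff_mult_scale_left cliff_mult_scale_right
        blade_sign_symdiff_left blade_sign_symdiff_right vector_smult_assoc mult_ac)
qed

lemma cliff_mult_assoc: "u \<odot> v \<odot> w = u \<odot> (v \<odot> w)"
  by (subst (1 2) blade_expand [of u], subst (1 2) blade_expand [of v],
      subst (1 2) blade_expand [of w])
     (simp add: cliff_mult_sum_left cliff_mult_sum_right cliff_mult_scale_left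
        cliff_mult_scale_right blade_mult_assoc)


section \<open>Dirac operator and spherical monogenics\<close>

text \<open>
  Partial derivatives are taken within \<open>S\<close>, so that the operator makes sense up to the boundary
  of the closed ball; for \<open>S = UNIV\<close> these are the ordinary partial derivatives.
\<close>

definition dirac_on ::
    "(real ^ 'n::{finite,linorder}) set \<Rightarrow> (real ^ 'n::{finite,linorder} \<Rightarrow> 'n clifford) \<Rightarrow> real ^ 'n::{finite,linorder} \<Rightarrow> 'n clifford"
  where
  "dirac_on S f x = (\<Sum>j\<in>UNIV. gen j \<odot> frechet_derivative f (at x within S) (axis j 1))"

definition homogeneous_polynomial ::
    "nat \<Rightarrow> (real ^ 'n::{finite,linorder} \<Rightarrow> 'n clifford) \<Rightarrow> bool" where
  "homogeneous_polynomial k Y \<longleftrightarrow>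
     (\<exists>C :: ('n \<Rightarrow> nat) \<Rightarrow> 'n clifford.
        \<forall>x. Y x = (\<Sum>a | (\<Sum>j\<in>UNIV. a j) = k. (\<Prod>j\<in>UNIV. (x $ j) ^ a j) *\<^sub>R C a))"

lemma finite_multi_indices: "finite {a :: 'n::finite \<Rightarrow> nat. (\<Sum>j\<in>UNIV. a j) = k}"
proof (rule finite_subset)
  show "{a :: 'n \<Rightarrow> nat. (\<Sum>j\<in>UNIV. a j) = k} \<subseteq> PiE UNIV (\<lambda>_. {..k})"
    by (auto intro: member_le_sum)
  show "finite (PiE UNIV (\<lambda>_::'n. {..k}))"
    by (intro finite_PiE) auto
qed

definition spherical_monogenic ::
    "nat \<Rightarrow> (real ^ 'n::{finite,linorder} \<Rightarrow> 'n clifford) \<Rightarrow> bool" where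
  "spherical_monogenic k Y \<longleftrightarrow>
     homogeneous_polynomial k Y \<and> (\<forall>x. dirac_on UNIV Y x = 0)"


section \<open>Clifford prolate spheroidal wave functions\<close>

definition prolate_op ::
    "real \<Rightarrow> (real ^ 'n::{finite,linorder} \<Rightarrow> 'n clifford) \<Rightarrow> real ^ 'n::{finite,linorder} \<Rightarrow> 'n clifford" where
  "prolate_op c f x =
     dirac_on (cball 0 1) (\<lambda>y. (1 - (norm y)\<^sup>2) *\<^sub>R dirac_on (cball 0 1) f y) x
       + (4 * pi\<^sup>2 * c\<^sup>2 * (norm x)\<^sup>2) *\<^sub>R f x"

text \<open>
  The differentiability conditions say exactly that both derivatives in \<^const>\<open>prolate_op\<close>
  exist on the closed ball.
\<close>

definition cpswf :: "real \<Rightarrow> (real ^ 'n::{finite,linorder} \<Rightarrow> 'n clifford) \<Rightarrow> bool" where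
  "cpswf c f \<longleftrightarrow>
     f differentiable_on cball 0 1 \<and>
     (\<lambda>y. (1 - (norm y)\<^sup>2) *\<^sub>R dirac_on (cball 0 1) f y) differentiable_on cball 0 1 \<and>
     (\<exists>x\<in>cball 0 1. f x \<noteq> 0) \<and>
     (\<exists>\<kappa>::complex. \<forall>x\<in>cball 0 1. prolate_op c f x = \<kappa> *s f x)"

definition finite_fourier ::
    "real \<Rightarrow> (real ^ 'n::{finite,linorder} \<Rightarrow> 'n clifford) \<Rightarrow> real ^ 'n::{finite,linorder} \<Rightarrow> 'n clifford" where
  "finite_fourier c f x =
     (LINT y:cball 0 1|lborel. exp (2 * of_real pi * \<i> * of_real (c * (x \<bullet> y))) *s f y)"


section \<open>The finite Hankel transform\<close>

text \<open>
  The Bessel function \<open>J\<^sub>\<alpha>\<close> for real order and \<open>z > 0\<close>, the only arguments that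
  occur. Using \<^const>\<open>rGamma\<close> makes the terms at poles of the Gamma function vanish. For
  \<open>z \<le> 0\<close> the value is meaningless because of the conventions for \<open>powr\<close>.
\<close>

definition bessel_J :: "real \<Rightarrow> real \<Rightarrow> real" where
  "bessel_J \<alpha> z =
     (\<Sum>n. (- 1) ^ n / fact n * rGamma (real n + \<alpha> + 1) * (z / 2) powr (2 * real n + \<alpha>))"

definition hankel_kernel :: "real \<Rightarrow> real \<Rightarrow> real \<Rightarrow> real \<Rightarrow> real" where
  "hankel_kernel c \<alpha> x y = sqrt (2 * pi * c * x * y) * bessel_J \<alpha> (2 * pi * c * x * y)"

definition finite_hankel :: "real \<Rightarrow> real \<Rightarrow> (real \<Rightarrow> complex) \<Rightarrow> real \<Rightarrow> complex" where
  "finite_hankel c \<alpha> f x =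
     of_real (sqrt (2 * pi)) * (LINT y:{0<..<1}|lborel. of_real (hankel_kernel c \<alpha> x y) * f y)"

text \<open>
  Besides the eigenvalue equation, an eigenfunction must have an absolutely convergent transform
  (a divergent integral would silently be \<open>0\<close>) and must be nonzero as an element of a space
  of functions modulo null sets.
\<close>

definition hankel_eigenfunction ::
    "real \<Rightarrow> real \<Rightarrow> (real \<Rightarrow> complex) \<Rightarrow> complex \<Rightarrow> bool" where
  "hankel_eigenfunction c \<alpha> \<phi> \<gamma> \<longleftrightarrow>
     (\<forall>x\<in>{0<..<1}. set_integrable lborel {0<..<1} (\<lambda>y. of_real (hankel_kernel c \<alpha> x y) * \<phi> y)) \<and>
     \<not> (AE r\<in>{0<..<1} in lborel. \<phi> r = 0) \<and>
     (\<forall>x\<in>{0<..<1}. finite_hankel c \<alpha> \<phi> x = \<gamma> * \<phi> x)"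

end

theory Submission
  imports Defs "HOL-Probability.Distributions"
begin

text \<open>
  The product \<open>x Y\<^sub>k(x)\<close> is, like \<open>Y\<^sub>k\<close> itself, a Clifford-valued
  homogeneous harmonic polynomial, of degree \<open>k + 1\<close>: the Dirac operator is a square root of
  \<open>-\<Delta>\<close>, and \<open>\<Delta>(x Y) = 2 \<partial>Y + x \<Delta>Y\<close>
  (\<open>dirac_square\<close>, \<open>laplacian_cliff_vec_mult\<close>). Hence, after passing to one
  coordinate of the Clifford algebra, the even and the odd case are the same statement about a
  complex harmonic polynomial \<open>H\<close> of some degree \<open>d\<close>: if \<open>G(|x|\<^sup>2) H(x)\<close>
  is an eigenfunction of the finite Fourier transform, then its radial profile is an eigenfunction
  of the finite Hankel transform of order \<open>d + m/2 - 1\<close>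
  (\<open>hankel_eigenfunction_of_harmonic\<close>).

  That reduction is the Bochner formula, which says that the Fourier transform acts on
  \<open>G(|x|\<^sup>2) H(x)\<close> by a Hankel transform in the radius. It is obtained here by expanding
  the exponential: only the moments of \<open>H(y) \<langle>x,y\<rangle>\<^sup>j\<close> over the unit sphere
  are needed, and they turn out to be the coefficients of the Bessel series times \<open>H(x)\<close>.

  Two facts give these spherical moments. Integration in polar coordinates
  (\<open>polar_integral\<close>) turns the integral of a homogeneous function against any radial
  weight into its integral over the sphere times a one-dimensional integral, so one may replace the
  ball by the Gaussian weight. For the Gaussian, integration by parts in the direction
  \<open>x\<close> gives the two-term recursion
  \<open>2 M\<^sub>j(H) = M\<^bsub>j-1\<^esub>(\<partial>\<^sub>x H) + (j-1) |x|\<^sup>2 M\<^bsub>j-2\<^esub>(H)\<close>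
  for \<open>M\<^sub>j(H) = \<integral> H(y) \<langle>x,y\<rangle>\<^sup>j exp(-|y|\<^sup>2) dy\<close>.
  It stays within harmonic polynomials, and Euler's identity
  \<open>\<partial>\<^sub>x H(x) = d H(x)\<close> closes it (\<open>gauss_moment_harmonic\<close>).
  The Gamma factors of the Bessel series come from the radial Gaussian moments.
\<close>

section \<open>Vector-valued polynomial functions and their directional derivatives\<close>

text \<open>
  Building polynomials by multiplying with linear forms \<open>x \<bullet> v\<close>, rather than with coordinates,
  makes the class visibly closed under directional derivatives and under multiplication by
  \<open>\<langle>x,y\<rangle>\<^sup>j\<close>, and gives an induction that needs no basis.
\<close>

inductive polyfn :: "('a::euclidean_space \<Rightarrow> 'b::real_normed_vector) \<Rightarrow> bool" where
  const: "polyfn (\<lambda>_. u)"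
| add: "polyfn f \<Longrightarrow> polyfn g \<Longrightarrow> polyfn (\<lambda>x. f x + g x)"
| times_inner: "polyfn f \<Longrightarrow> polyfn (\<lambda>x. (x \<bullet> v) *\<^sub>R f x)"

definition pd :: "'a::euclidean_space \<Rightarrow> ('a \<Rightarrow> 'b::real_normed_vector) \<Rightarrow> 'a \<Rightarrow> 'b" where
  "pd v f x = frechet_derivative f (at x) v"

definition laplacian :: "('a::euclidean_space \<Rightarrow> 'b::real_normed_vector) \<Rightarrow> 'a \<Rightarrow> 'b" where
  "laplacian f x = (\<Sum>b\<in>Basis. pd b (pd b f) x)"

text \<open>
  Homogeneity is required for positive factors only, so that positive and negative parts of a
  homogeneous function are homogeneous as well.
\<close>

definition pos_homogeneous :: "nat \<Rightarrow> ('a::real_vector \<Rightarrow> 'b::real_vector) \<Rightarrow> bool" where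
  "pos_homogeneous k f \<longleftrightarrow> (\<forall>t>0. \<forall>x. f (t *\<^sub>R x) = t ^ k *\<^sub>R f x)"

lemma pos_homogeneousD: "pos_homogeneous k f \<Longrightarrow> t > 0 \<Longrightarrow> f (t *\<^sub>R x) = t ^ k *\<^sub>R f x"
  by (auto simp: pos_homogeneous_def)

lemma polyfn_sum: "(\<And>i. i \<in> I \<Longrightarrow> polyfn (f i)) \<Longrightarrow> polyfn (\<lambda>x. \<Sum>i\<in>I. f i x)"
  by (induction I rule: infinite_finite_induct) (auto intro: polyfn.intros)

lemma polyfn_bounded_linear:
  assumes "bounded_linear L" "polyfn f"
  shows "polyfn (\<lambda>x. L (f x))"
proof -
  interpret bounded_linear L by fact
  show ?thesis using assms(2)
    by (induction rule: polyfn.induct) (auto intro: polyfn.intros simp: add scaleR)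
qed

lemma polyfn_scaleR: "polyfn f \<Longrightarrow> polyfn (\<lambda>x. a *\<^sub>R f x)"
  by (rule polyfn_bounded_linear [OF bounded_linear_scaleR_right])

lemma polyfn_differentiable: "polyfn f \<Longrightarrow> f differentiable (at x)"
  by (induction rule: polyfn.induct) auto

lemma polyfn_has_derivative: "polyfn f \<Longrightarrow> (f has_derivative (\<lambda>v. pd v f x)) (at x)"
  unfolding pd_def using frechet_derivative_works polyfn_differentiable by blast

lemma pd_eqI: "(f has_derivative f') (at x) \<Longrightarrow> pd v f x = f' v"
  unfolding pd_def using frechet_derivative_at by metis

lemma polyfn_continuous: "polyfn f \<Longrightarrow> continuous_on S f"
  by (meson continuous_at_imp_continuous_on differentiable_imp_continuous_within polyfn_differentiable)

lemma pd_const [simp]: "pd v (\<lambda>_. u) = (\<lambda>_. 0)"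
  by (rule ext, rule pd_eqI [where f' = "\<lambda>_. 0"]) auto

lemma pd_add:
  assumes "polyfn f" "polyfn g"
  shows "pd v (\<lambda>x. f x + g x) = (\<lambda>x. pd v f x + pd v g x)"
  by (rule ext, rule pd_eqI) (intro derivative_intros polyfn_has_derivative assms)

lemma pd_sum:
  assumes "\<And>i. i \<in> I \<Longrightarrow> polyfn (f i)"
  shows "pd v (\<lambda>x. \<Sum>i\<in>I. f i x) = (\<lambda>x. \<Sum>i\<in>I. pd v (f i) x)"
  by (rule ext, rule pd_eqI) (intro derivative_intros polyfn_has_derivative assms)

lemma pd_bounded_linear:
  assumes "bounded_linear L" "polyfn f"
  shows "pd v (\<lambda>x. L (f x)) = (\<lambda>x. L (pd v f x))"
  by (rule ext, rule pd_eqI)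
    (rule bounded_linear.has_derivative [OF assms(1) polyfn_has_derivative [OF assms(2)]])

lemma pd_times_inner:
  assumes "polyfn f"
  shows "pd w (\<lambda>x. (x \<bullet> v) *\<^sub>R f x) = (\<lambda>x. (w \<bullet> v) *\<^sub>R f x + (x \<bullet> v) *\<^sub>R pd w f x)"
proof
  fix x
  have "((\<lambda>x. (x \<bullet> v) *\<^sub>R f x) has_derivative
     (\<lambda>w. (x \<bullet> v) *\<^sub>R pd w f x + (w \<bullet> v) *\<^sub>R f x)) (at x)"
    by (intro derivative_intros polyfn_has_derivative assms)
  then show "pd w (\<lambda>x. (x \<bullet> v) *\<^sub>R f x) x = (w \<bullet> v) *\<^sub>R f x + (x \<bullet> v) *\<^sub>R pd w f x"
    by (subst pd_eqI) (auto simp: add.commute)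
qed

lemma polyfn_pd: "polyfn f \<Longrightarrow> polyfn (pd v f)"
  by (induction rule: polyfn.induct)
    (auto simp: pd_add pd_times_inner intro!: polyfn.intros polyfn_scaleR)

lemma pd_scaleR: "polyfn f \<Longrightarrow> pd v (\<lambda>x. a *\<^sub>R f x) = (\<lambda>x. a *\<^sub>R pd v f x)"
  by (rule pd_bounded_linear [OF bounded_linear_scaleR_right])

lemma pd_commute: "polyfn f \<Longrightarrow> pd v (pd w f) = pd w (pd v f)"
proof (induction rule: polyfn.induct)
  case (times_inner f u)
  then show ?case
    by (auto simp: pd_times_inner pd_add polyfn_pd polyfn_scaleR pd_scaleR polyfn.intros algebra_simps)
qed (simp_all add: pd_add polyfn_pd)

lemma pd_linear: "polyfn f \<Longrightarrow> linear (\<lambda>v. pd v f x)"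
  using polyfn_has_derivative bounded_linear.linear has_derivative_bounded_linear by blast

lemma pd_expand:
  assumes "polyfn f"
  shows "pd v f x = (\<Sum>b\<in>Basis. (v \<bullet> b) *\<^sub>R pd b f x)"
proof -
  have "pd v f x = pd (\<Sum>b\<in>Basis. (v \<bullet> b) *\<^sub>R b) f x"
    by (simp add: euclidean_representation)
  then show ?thesis
    by (simp add: linear_sum [OF pd_linear [OF assms]] linear_scale [OF pd_linear [OF assms]])
qed

lemma pd_homogeneous:
  assumes "polyfn f" "pos_homogeneous (Suc k) f"
  shows "pos_homogeneous k (pd v f)"
  unfolding pos_homogeneous_def
proof (intro allI impI)
  fix t :: real and x assume t: "t > 0"
  have "((\<lambda>x. f (t *\<^sub>R x)) has_derivative (\<lambda>w. pd (t *\<^sub>R w) f (t *\<^sub>R x))) (at x)"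
    by (rule has_derivative_compose [OF _ polyfn_has_derivative [OF assms(1)]])
      (auto intro!: derivative_eq_intros)
  then have "pd v (\<lambda>x. f (t *\<^sub>R x)) x = t *\<^sub>R pd v f (t *\<^sub>R x)"
    by (simp add: pd_eqI linear_scale [OF pd_linear [OF assms(1)]])
  moreover have "pd v (\<lambda>x. f (t *\<^sub>R x)) x = t ^ Suc k *\<^sub>R pd v f x"
    using assms t by (simp add: pos_homogeneousD pd_scaleR del: power_Suc)
  ultimately show "pd v f (t *\<^sub>R x) = t ^ k *\<^sub>R pd v f x"
    using t by (simp add: scaleR_scaleR [symmetric] del: scaleR_scaleR)
qed

text \<open>
  Homogeneity of degree \<open>0\<close> under positive factors makes \<open>f\<close> constant on open rays;
  continuity at the origin links the rays.
\<close>

lemma homogeneous_0_const: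
  assumes "polyfn f" "pos_homogeneous 0 f"
  shows "f x = f 0"
proof -
  have "(\<lambda>n. f (inverse (real (Suc n)) *\<^sub>R x)) \<longlonglongrightarrow> f 0"
  proof (rule continuous_on_tendsto_compose [OF polyfn_continuous [OF assms(1), of UNIV]])
    show "(\<lambda>n. inverse (real (Suc n)) *\<^sub>R x) \<longlonglongrightarrow> 0"
      using tendsto_scaleR [OF LIMSEQ_inverse_real_of_nat tendsto_const [of x]] by simp
  qed auto
  then have "(\<lambda>n. f x) \<longlonglongrightarrow> f 0"
    using assms(2) by (simp add: pos_homogeneousD)
  then show ?thesis by (simp add: LIMSEQ_const_iff)
qed

text \<open>
  Euler's identity: both sides are the derivative of \<open>t \<mapsto> f (t x)\<close> at \<open>t = 1\<close>.
\<close>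

lemma euler_homogeneous:
  assumes "polyfn f" "pos_homogeneous k f"
  shows "pd x f x = real k *\<^sub>R f x"
proof -
  have 1: "((\<lambda>t::real. f (t *\<^sub>R x)) has_vector_derivative pd x f (1 *\<^sub>R x)) (at 1)"
    unfolding has_vector_derivative_def
    by (rule has_derivative_eq_rhs, rule has_derivative_compose [OF _ polyfn_has_derivative [OF assms(1)]])
      (auto intro!: derivative_eq_intros ext simp: linear_scale [OF pd_linear [OF assms(1)]])
  have "((\<lambda>t::real. t ^ k *\<^sub>R f x) has_vector_derivative real k *\<^sub>R f x) (at 1)"
    unfolding has_vector_derivative_def
    by (auto intro!: derivative_eq_intros)
  then have "((\<lambda>t::real. f (t *\<^sub>R x)) has_vector_derivative real k *\<^sub>R f x) (at 1)"
    by (rule has_vector_derivative_transform_within_open [where S = "{0<..}"])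
      (auto simp: pos_homogeneousD [OF assms(2)])
  with 1 show ?thesis by (simp add: vector_derivative_unique_at)
qed

text \<open>
  This keeps the recursion for the Gaussian moments inside the harmonic polynomials.
\<close>

lemma laplacian_pd:
  assumes "polyfn f" "\<And>x. laplacian f x = 0"
  shows "laplacian (pd v f) x = 0"
proof -
  have "laplacian (pd v f) x = pd v (\<lambda>x. \<Sum>b\<in>Basis. pd b (pd b f) x) x"
    using assms(1) by (simp add: laplacian_def pd_sum polyfn_pd pd_commute [of _ v])
  also have "(\<lambda>x. \<Sum>b\<in>Basis. pd b (pd b f) x) = (\<lambda>x. 0)"
    using assms(2) by (simp add: laplacian_def)
  finally show ?thesis by simp
qed

section \<open>Integration in polar coordinates\<close>

text \<open>
  For a function that is homogeneous of degree \<open>d\<close> this is its integral over the unit sphere with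
  respect to surface measure: radial integration over the ball contributes the factor
  \<open>\<integral>\<^sub>0\<^sup>1 r\<^bsup>n + d - 1\<^esup> dr = 1 / (n + d)\<close>.
  Defining it through the ball avoids surface measure.
\<close>

definition sphere_integral :: "nat \<Rightarrow> ('a::euclidean_space \<Rightarrow> 'b::{banach, second_countable_topology}) \<Rightarrow> 'b" where
  "sphere_integral d h = real (DIM('a) + d) *\<^sub>R (LINT y:cball 0 1|lborel. h y)"

lemma set_integrable_cball:
  fixes h :: "'a::euclidean_space \<Rightarrow> 'b::{banach, second_countable_topology}"
  assumes "continuous_on (cball 0 r) h"
  shows "set_integrable lborel (cball 0 r) h"
  unfolding set_integrable_def using assms by (intro borel_integrable_compact) auto

lemma nn_integral_cball_homogeneous:
  fixes h :: "'a::euclidean_space \<Rightarrow> real"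
  assumes h [measurable]: "h \<in> borel_measurable borel"
    and hom: "pos_homogeneous d h" and r: "r > 0"
  shows "(\<integral>\<^sup>+y\<in>cball 0 r. ennreal (h y) \<partial>lborel)
    = ennreal (r ^ (DIM('a) + d)) * (\<integral>\<^sup>+y\<in>cball 0 1. ennreal (h y) \<partial>lborel)"
proof -
  have [measurable]: "cball (0::'a) s \<in> sets borel" for s
    by (intro borel_closed closed_cball)
  have "(\<integral>\<^sup>+y\<in>cball 0 r. ennreal (h y) \<partial>lborel) =
    (\<integral>\<^sup>+y. ennreal (r ^ DIM('a)) * (ennreal (h (r *\<^sub>R y)) * indicator (cball 0 r) (r *\<^sub>R y)) \<partial>lborel)"
    using r by (subst lborel_affine [of r 0])
        (simp_all add: nn_integral_density nn_integral_distr ennreal_power)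
  also have "\<dots> = (\<integral>\<^sup>+y. ennreal (r ^ (DIM('a) + d)) * (ennreal (h y) * indicator (cball 0 1) y) \<partial>lborel)"
  proof (intro nn_integral_cong)
    fix y :: 'a
    have "indicator (cball 0 r) (r *\<^sub>R y) = (indicator (cball 0 1) y :: ennreal)"
      using r by (auto simp: indicator_def mult_le_cancel_left1)
    then show "ennreal (r ^ DIM('a)) * (ennreal (h (r *\<^sub>R y)) * indicator (cball 0 r) (r *\<^sub>R y))
      = ennreal (r ^ (DIM('a) + d)) * (ennreal (h y) * indicator (cball 0 1) y)"
      using r by (simp add: pos_homogeneousD [OF hom] power_add ennreal_mult' mult.assoc)
  qed
  also have "\<dots> = ennreal (r ^ (DIM('a) + d)) * (\<integral>\<^sup>+y\<in>cball 0 1. ennreal (h y) \<partial>lborel)"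
    by (rule nn_integral_cmult) measurable
  finally show ?thesis .
qed

text \<open>
  Both measures give \<open>r\<^bsup>n + d\<^esup>\<close> times a constant to \<open>{..r}\<close>, the left one by
  scaling; this determines a measure on the line.
\<close>

lemma polar_measure:
  fixes h :: "'a::euclidean_space \<Rightarrow> real"
  assumes cont: "continuous_on UNIV h" and nonneg: "\<And>y. h y \<ge> 0"
    and hom: "pos_homogeneous d h"
  shows "distr (density lborel h) borel norm
    = density lborel (\<lambda>r. ennreal (indicator {0..} r * (sphere_integral d h * r ^ (DIM('a) + d - 1))))"
    (is "?M = ?N")
proof -
  have [measurable]: "h \<in> borel_measurable borel"
    using cont by (rule borel_measurable_continuous_onI)
  define V where "V = (LINT y:cball 0 1|lborel. h y)"
  have V0: "V \<ge> 0"
    unfolding V_def set_lebesgue_integral_def by (intro integral_nonneg_AE) (auto simp: nonneg)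
  have VI: "(\<integral>\<^sup>+y\<in>cball 0 1. ennreal (h y) \<partial>lborel) = ennreal V"
  proof -
    have "(\<integral>\<^sup>+y\<in>cball 0 1. ennreal (h y) \<partial>lborel)
      = (\<integral>\<^sup>+y. ennreal (indicator (cball 0 1) y *\<^sub>R h y) \<partial>lborel)"
      by (intro nn_integral_cong) (simp add: indicator_def)
    also have "\<dots> = ennreal V"
      unfolding V_def set_lebesgue_integral_def
      using set_integrable_cball [OF continuous_on_subset [OF cont subset_UNIV]]
      by (intro nn_integral_eq_integral) (auto simp: nonneg set_integrable_def)
    finally show ?thesis .
  qed
  have M: "emeasure ?M {..r} = (if r \<le> 0 then 0 else ennreal (r ^ (DIM('a) + d) * V))" for r
  proof -
    have v: "cball (0::'a) r = norm -` {..r}"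
      by auto
    have "emeasure ?M {..r} = (\<integral>\<^sup>+y\<in>cball 0 r. ennreal (h y) \<partial>lborel)"
      by (subst emeasure_distr, simp, simp, subst emeasure_density)
        (auto intro!: nn_integral_cong simp: v [symmetric] borel_closed indicator_def)
    also have "\<dots> = (if r \<le> 0 then 0 else ennreal (r ^ (DIM('a) + d) * V))"
    proof (cases "r \<le> 0")
      case True
      have "AE y in lborel. y \<noteq> (0::'a)"
        by (rule AE_lborel_singleton)
      then have "(\<integral>\<^sup>+y\<in>cball 0 r. ennreal (h y) \<partial>lborel) = (\<integral>\<^sup>+(y::'a). 0 \<partial>lborel)"
        by (intro nn_integral_cong_AE, elim eventually_mono)
          (use True in \<open>auto simp: indicator_def dest: order_trans [of "norm _" r 0]\<close>)
      then show ?thesis using True by simp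
    next
      case False
      then show ?thesis
        using nn_integral_cball_homogeneous [OF _ hom, of r] V0 by (simp add: VI ennreal_mult)
    qed
    finally show ?thesis .
  qed
  have N: "emeasure ?N {..r} = (if r \<le> 0 then 0 else ennreal (r ^ (DIM('a) + d) * V))" for r
  proof -
    let ?e = "DIM('a) + d"
    have e: "?e > 0" by simp
    have "emeasure ?N {..r} = (\<integral>\<^sup>+t. ennreal (sphere_integral d h * t ^ (?e - 1)) * indicator {0..r} t \<partial>lborel)"
      by (subst emeasure_density) (auto intro!: nn_integral_cong simp: indicator_def)
    also have "\<dots> = (if r \<le> 0 then 0 else ennreal (r ^ ?e * V))"
    proof (cases "r \<le> 0")
      case True
      have "AE t in lborel. t \<noteq> (0::real)"
        by (rule AE_lborel_singleton)
      then have "(\<integral>\<^sup>+t. ennreal (sphere_integral d h * t ^ (?e - 1)) * indicator {0..r} t \<partial>lborel) = (\<integral>\<^sup>+(t::real). 0 \<partial>lborel)"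
        by (intro nn_integral_cong_AE) (use True in \<open>auto simp: indicator_def\<close>)
      then show ?thesis using True by simp
    next
      case False
      have "(\<integral>\<^sup>+t. ennreal (sphere_integral d h * t ^ (?e - 1)) * indicator {0..r} t \<partial>lborel)
        = ennreal (V * r ^ ?e - V * 0 ^ ?e)"
        using False V0
        by (intro nn_integral_FTC_Icc)
          (auto intro!: derivative_eq_intros simp: sphere_integral_def V_def [symmetric])
      then show ?thesis using False zero_power [OF e, where 'a = real] by (simp add: mult.commute)
    qed
    finally show ?thesis .
  qed
  show ?thesis
  proof (rule measure_eqI_generator_eq [where E = "range (\<lambda>r::real. {..r})" and \<Omega> = UNIV and A = "\<lambda>i. {..real i}"])
    show "Int_stable (range (\<lambda>r::real. {..r}))"
      by (rule Int_stableI) auto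
    show "(\<Union>i. {..real i}) = UNIV"
      using real_arch_simple by auto
    show "sets ?M = sigma_sets UNIV (range (\<lambda>r::real. {..r}))" "sets ?N = sigma_sets UNIV (range (\<lambda>r::real. {..r}))"
      by (simp_all add: borel_eq_atMost)
    show "emeasure ?M X = emeasure ?N X" if "X \<in> range (\<lambda>r::real. {..r})" for X
      using that by (elim rangeE) (simp only: M N)
    show "emeasure ?M {..real i} \<noteq> \<infinity>" for i
      by (simp only: M) simp
  qed auto
qed

lemma polar_integrable_nonneg:
  fixes h :: "'a::euclidean_space \<Rightarrow> real" and f :: "real \<Rightarrow> complex"
  assumes cont: "continuous_on UNIV h" and nonneg: "\<And>y. h y \<ge> 0"
    and hom: "pos_homogeneous d h" and f [measurable]: "f \<in> borel_measurable borel"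
    and int: "integrable lborel (\<lambda>r. indicator {0..} r *\<^sub>R (of_real (r ^ (DIM('a) + d - 1)) * f r))"
  shows "integrable lborel (\<lambda>y. f (norm y) * of_real (h y))"
proof -
  have [measurable]: "h \<in> borel_measurable borel"
    using cont by (rule borel_measurable_continuous_onI)
  have S: "sphere_integral d h \<ge> 0"
    unfolding sphere_integral_def set_lebesgue_integral_def
    by (intro scaleR_nonneg_nonneg integral_nonneg_AE) (auto simp: nonneg)
  have "integrable (density lborel (\<lambda>r. ennreal (indicator {0..} r * (sphere_integral d h * r ^ (DIM('a) + d - 1))))) f
     \<longleftrightarrow> integrable lborel (\<lambda>r. of_real (sphere_integral d h) * (indicator {0..} r *\<^sub>R (of_real (r ^ (DIM('a) + d - 1)) * f r)))"
    using S by (subst integrable_density) (auto simp: indicator_def scaleR_conv_of_real mult_ac intro!: arg_cong [where f = "integrable lborel"])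
  also have \<dots>
    by (intro integrable_mult_right int)
  finally have "integrable (distr (density lborel h) borel norm) f"
    by (simp add: polar_measure [OF cont nonneg hom])
  then show ?thesis
    by (subst (asm) integrable_distr_eq, simp, simp, subst (asm) integrable_density)
       (auto simp: nonneg scaleR_conv_of_real mult_ac)
qed

lemma polar_integral_nonneg:
  fixes h :: "'a::euclidean_space \<Rightarrow> real" and f :: "real \<Rightarrow> complex"
  assumes cont: "continuous_on UNIV h" and nonneg: "\<And>y. h y \<ge> 0"
    and hom: "pos_homogeneous d h" and f [measurable]: "f \<in> borel_measurable borel"
  shows "(LINT y|lborel. f (norm y) * of_real (h y))
    = of_real (sphere_integral d h) * (LINT r:{0..}|lborel. of_real (r ^ (DIM('a) + d - 1)) * f r)"
proof -
  have [measurable]: "h \<in> borel_measurable borel"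
    using cont by (rule borel_measurable_continuous_onI)
  have S: "sphere_integral d h \<ge> 0"
    unfolding sphere_integral_def set_lebesgue_integral_def
    by (intro scaleR_nonneg_nonneg integral_nonneg_AE) (auto simp: nonneg)
  have "(LINT y|lborel. f (norm y) * of_real (h y)) = integral\<^sup>L (distr (density lborel h) borel norm) f"
    by (subst integral_distr, simp, simp, subst integral_density)
       (auto simp: nonneg scaleR_conv_of_real mult_ac)
  also have "\<dots> = integral\<^sup>L (density lborel (\<lambda>r. ennreal (indicator {0..} r * (sphere_integral d h * r ^ (DIM('a) + d - 1))))) f"
    by (simp add: polar_measure [OF cont nonneg hom])
  also have "\<dots> = (LINT r|lborel. of_real (sphere_integral d h) * (indicator {0..} r *\<^sub>R (of_real (r ^ (DIM('a) + d - 1)) * f r)))"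
    using S by (subst integral_density) (auto simp: indicator_def scaleR_conv_of_real mult_ac intro!: Bochner_Integration.integral_cong)
  also have "\<dots> = of_real (sphere_integral d h) * (LINT r:{0..}|lborel. of_real (r ^ (DIM('a) + d - 1)) * f r)"
    by (simp add: set_lebesgue_integral_def del: mult_scaleR_right)
  finally show ?thesis .
qed

text \<open>
  The positive and the negative part of \<open>h\<close> are again homogeneous.
\<close>

lemma polar_integral_real:
  fixes h :: "'a::euclidean_space \<Rightarrow> real" and f :: "real \<Rightarrow> complex"
  assumes cont: "continuous_on UNIV h"
    and hom: "pos_homogeneous d h" and f [measurable]: "f \<in> borel_measurable borel"
    and int: "integrable lborel (\<lambda>y. f (norm y) * of_real (h y))"
  shows "(LINT y|lborel. f (norm y) * of_real (h y))
    = of_real (sphere_integral d h) * (LINT r:{0..}|lborel. of_real (r ^ (DIM('a) + d - 1)) * f r)"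
proof -
  have [measurable]: "h \<in> borel_measurable borel"
    using cont by (rule borel_measurable_continuous_onI)
  let ?p = "\<lambda>y. max (h y) 0" and ?q = "\<lambda>y. max (- h y) 0"
  have cp: "continuous_on UNIV ?p" and cq: "continuous_on UNIV ?q"
    by (intro continuous_intros cont)+
  have hp: "pos_homogeneous d ?p" and hq: "pos_homogeneous d ?q"
    unfolding pos_homogeneous_def
    by (simp_all add: pos_homogeneousD [OF hom] max_mult_distrib_left)
  have ip: "integrable lborel (\<lambda>y. f (norm y) * of_real (?p y))"
    and iq: "integrable lborel (\<lambda>y. f (norm y) * of_real (?q y))"
    by (rule Bochner_Integration.integrable_bound [OF int]; force simp: norm_mult max_def mult_left_mono intro!: mult_left_mono)+
  have split: "h y = ?p y - ?q y" for y by (simp add: max_def)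
  have "sphere_integral d h = sphere_integral d ?p - sphere_integral d ?q"
  proof -
    have "(LINT y:cball 0 1|lborel. h y) = (LINT y:cball 0 1|lborel. ?p y - ?q y)"
      by (simp flip: split)
    also have "\<dots> = (LINT y:cball 0 1|lborel. ?p y) - (LINT y:cball 0 1|lborel. ?q y)"
      by (intro set_integral_diff set_integrable_cball continuous_on_subset [OF cp] continuous_on_subset [OF cq]) auto
    finally show ?thesis
      by (simp add: sphere_integral_def right_diff_distrib)
  qed
  moreover have "(LINT y|lborel. f (norm y) * of_real (h y)) =
     (LINT y|lborel. f (norm y) * of_real (?p y)) - (LINT y|lborel. f (norm y) * of_real (?q y))"
    by (subst Bochner_Integration.integral_diff [OF ip iq, symmetric], subst split) (simp add: algebra_simps)
  ultimately show ?thesis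
    by (simp add: polar_integral_nonneg [OF cp _ hp f] polar_integral_nonneg [OF cq _ hq f] left_diff_distrib)
qed

lemma polar_integral:
  fixes h :: "'a::euclidean_space \<Rightarrow> complex" and f :: "real \<Rightarrow> complex"
  assumes cont: "continuous_on UNIV h"
    and hom: "pos_homogeneous d h" and f [measurable]: "f \<in> borel_measurable borel"
    and int: "integrable lborel (\<lambda>y. f (norm y) * h y)"
  shows "(LINT y|lborel. f (norm y) * h y)
    = sphere_integral d h * (LINT r:{0..}|lborel. of_real (r ^ (DIM('a) + d - 1)) * f r)"
proof -
  have [measurable]: "h \<in> borel_measurable borel"
    using cont by (rule borel_measurable_continuous_onI)
  let ?p = "\<lambda>y. Re (h y)" and ?q = "\<lambda>y. Im (h y)"
  have cp: "continuous_on UNIV ?p" and cq: "continuous_on UNIV ?q"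
    by (intro continuous_intros cont)+
  have hp: "pos_homogeneous d ?p" and hq: "pos_homogeneous d ?q"
    unfolding pos_homogeneous_def by (auto simp: pos_homogeneousD [OF hom])
  have ip: "integrable lborel (\<lambda>y. f (norm y) * of_real (?p y))"
    and iq: "integrable lborel (\<lambda>y. f (norm y) * of_real (?q y))"
    by (rule Bochner_Integration.integrable_bound [OF int]; 
        force simp: norm_mult abs_Re_le_cmod abs_Im_le_cmod intro!: mult_left_mono)+
  have split: "h y = of_real (?p y) + \<i> * of_real (?q y)" for y by (simp add: complex_eq)
  have cp': "set_integrable lborel (cball 0 1) (\<lambda>y. complex_of_real (?p y))"
    and cq': "set_integrable lborel (cball 0 1) (\<lambda>y. complex_of_real (?q y))"
    by (auto intro!: set_integrable_cball continuous_intros continuous_on_subset [OF cp] continuous_on_subset [OF cq])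
  have "(LINT y:cball 0 1|lborel. h y) = (LINT y:cball 0 1|lborel. of_real (?p y)) + \<i> * (LINT y:cball 0 1|lborel. of_real (?q y))"
    by (subst split, subst set_integral_add(2), rule cp', rule set_integrable_mult_right, rule cq') simp
  then have "sphere_integral d h = of_real (sphere_integral d ?p) + \<i> * of_real (sphere_integral d ?q)"
    unfolding sphere_integral_def by (simp add: set_integral_complex_of_real scaleR_conv_of_real algebra_simps)
  moreover have "(LINT y|lborel. f (norm y) * h y) =
     (LINT y|lborel. f (norm y) * of_real (?p y)) + \<i> * (LINT y|lborel. f (norm y) * of_real (?q y))"
    by (subst integral_mult_right_zero [symmetric], subst Bochner_Integration.integral_add [symmetric], rule ip,
        rule integrable_mult_right, rule iq, subst split) (simp add: algebra_simps)
  ultimately show ?thesis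
    by (simp add: polar_integral_real [OF cp hp f ip] polar_integral_real [OF cq hq f iq] algebra_simps)
qed

section \<open>Gaussian moments of harmonic polynomials\<close>

definition gauss :: "'a::euclidean_space \<Rightarrow> real" where
  "gauss y = exp (- (y \<bullet> y))"

lemma gauss_continuous: "continuous_on S gauss"
  unfolding gauss_def [abs_def] by (intro continuous_intros)

lemma gauss_measurable [measurable]: "gauss \<in> borel_measurable borel"
  by (intro borel_measurable_continuous_onI gauss_continuous)

lemma Gamma_half_nat: "Gamma (real k + 1 / 2) = sqrt pi * (fact (2 * k) / (2 ^ (2 * k) * fact k))"
proof (induction k)
  case 0
  then show ?case by (simp add: Gamma_one_half_real)
next
  case (Suc k)
  have "Gamma (real k + 1 / 2 + 1) = (real k + 1 / 2) * Gamma (real k + 1 / 2)"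
    by (rule Gamma_plus1) (auto simp: nonpos_Ints_def elim!: Ints_cases)
  then have "Gamma (real (Suc k) + 1 / 2)
      = (real k + 1 / 2) * (sqrt pi * (fact (2 * k) / (2 ^ (2 * k) * fact k)))"
    by (simp add: Suc add_ac)
  also have "\<dots> = sqrt pi * (fact (2 * Suc k) / (2 ^ (2 * Suc k) * fact (Suc k)))"
  proof -
    have "fact (2 * Suc k) = 4 * ((real k + 1) * (real k + 1 / 2)) * fact (2 * k)"
      by (simp add: algebra_simps)
    moreover have "(2::real) ^ (2 * Suc k) * fact (Suc k) = 4 * (real k + 1) * (2 ^ (2 * k) * fact k)"
      by (simp add: algebra_simps)
    ultimately show ?thesis by (simp only:) (simp add: divide_simps)
  qed
  finally show ?case .
qed

text \<open>
  For even and odd exponents these are known as factorial expressions; in terms of the Gamma function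
  the two cases coincide, which is the form in which they meet the Bessel series.
\<close>

lemma gaussian_radial_moment:
  "has_bochner_integral lborel (\<lambda>r::real. indicator {0..} r *\<^sub>R (exp (- r\<^sup>2) * r ^ e))
     (Gamma ((real e + 1) / 2) / 2)"
proof (cases "even e")
  case True
  then obtain k where e: "e = 2 * k" by (elim evenE)
  have "(real e + 1) / 2 = real k + 1 / 2" by (simp add: e field_simps)
  then have "Gamma ((real e + 1) / 2) / 2 = (sqrt pi / 2) * (fact (2 * k) / (2 ^ (2 * k) * fact k))"
    by (simp only: Gamma_half_nat) simp
  then show ?thesis
    using gaussian_moment_even_pos [of k] by (simp only: e)
next
  case False
  then obtain k where e: "e = 2 * k + 1" by (elim oddE)
  have "(real e + 1) / 2 = 1 + real k" by (simp add: e field_simps)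
  then have "Gamma ((real e + 1) / 2) / 2 = fact k / 2"
    by (simp only: Gamma_fact)
  then show ?thesis
    using gaussian_moment_odd_pos [of k] by (simp only: e)
qed

lemma gaussian_radial_integral:
  "(LINT r:{0..}|lborel. of_real (r ^ e) * complex_of_real (exp (- r\<^sup>2)))
     = of_real (Gamma ((real e + 1) / 2) / 2)"
proof -
  have "(LINT r:{0..}|lborel. of_real (r ^ e) * complex_of_real (exp (- r\<^sup>2)))
    = (LINT r:{0..}|lborel. complex_of_real (exp (- r\<^sup>2) * r ^ e))"
    by (simp add: mult.commute)
  also have "\<dots> = of_real (LINT r:{0..}|lborel. exp (- r\<^sup>2) * r ^ e)"
    by (rule set_integral_complex_of_real)
  also have "(LINT r:{0..}|lborel. exp (- r\<^sup>2) * r ^ e) = Gamma ((real e + 1) / 2) / 2"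
    using has_bochner_integral_integral_eq [OF gaussian_radial_moment [of e]]
    by (simp add: set_lebesgue_integral_def)
  finally show ?thesis .
qed

lemma gauss_norm: "complex_of_real (gauss y) = of_real (exp (- (norm y)\<^sup>2))"
  by (simp add: gauss_def power2_norm_eq_inner)

lemma gauss_norm_power_integrable:
  "integrable lborel (\<lambda>y::'a::euclidean_space. gauss y * norm y ^ i)"
proof -
  have "integrable lborel (\<lambda>y::'a. complex_of_real (exp (- (norm y)\<^sup>2)) * of_real (norm y ^ i))"
  proof (rule polar_integrable_nonneg [where f = "\<lambda>r. of_real (exp (- r\<^sup>2))" and d = i])
    have "integrable lborel (\<lambda>r. complex_of_real (indicator {0..} r *\<^sub>R (exp (- r\<^sup>2) * r ^ (DIM('a) + i - 1))))"
      using integrable.intros [OF gaussian_radial_moment] by (rule integrable_of_real)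
    then show "integrable lborel (\<lambda>r. indicator {0..} r *\<^sub>R
        (complex_of_real (r ^ (DIM('a) + i - 1)) * complex_of_real (exp (- r\<^sup>2))))"
      by (simp add: scaleR_conv_of_real mult_ac)
  qed (auto intro!: continuous_intros simp: pos_homogeneous_def power_mult_distrib)
  then have "integrable lborel (\<lambda>y::'a. complex_of_real (gauss y * norm y ^ i))"
    by (simp add: gauss_norm)
  then show ?thesis
    by (rule complex_of_real_integrable_eq [THEN iffD1])
qed

text \<open>
  Bounding by powers of \<open>1 + norm y\<close> lets the exponents in a sum be increased to a common one.
\<close>

lemma polyfn_bound:
  "polyfn f \<Longrightarrow> \<exists>C d. C \<ge> 0 \<and> (\<forall>y. norm (f y) \<le> C * (1 + norm y) ^ d)"
proof (induction rule: polyfn.induct)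
  case (const u)
  show ?case by (rule exI [of _ "norm u"], rule exI [of _ 0]) simp
next
  case (add f g)
  then obtain C d C' d' where *: "C \<ge> 0" "C' \<ge> 0" "\<And>y. norm (f y) \<le> C * (1 + norm y) ^ d"
    "\<And>y. norm (g y) \<le> C' * (1 + norm y) ^ d'" by blast
  have "norm (f y + g y) \<le> (C + C') * (1 + norm y) ^ (d + d')" for y
  proof -
    have "norm (f y) \<le> C * (1 + norm y) ^ (d + d')" "norm (g y) \<le> C' * (1 + norm y) ^ (d + d')"
      using * by (auto intro!: order_trans [OF *(3)] order_trans [OF *(4)] mult_left_mono power_increasing)
    then show ?thesis
      using norm_triangle_ineq [of "f y" "g y"] by (simp add: distrib_right)
  qed
  then show ?case using * by (intro exI [of _ "C + C'"] exI [of _ "d + d'"]) auto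
next
  case (times_inner f v)
  then obtain C d where *: "C \<ge> 0" "\<And>y. norm (f y) \<le> C * (1 + norm y) ^ d" by blast
  have "norm ((y \<bullet> v) *\<^sub>R f y) \<le> (norm v * C) * (1 + norm y) ^ Suc d" for y
  proof -
    have "\<bar>y \<bullet> v\<bar> \<le> (1 + norm y) * norm v"
      using Cauchy_Schwarz_ineq2 [of y v] by (simp add: distrib_right add_increasing)
    then have "\<bar>y \<bullet> v\<bar> * norm (f y) \<le> ((1 + norm y) * norm v) * (C * (1 + norm y) ^ d)"
      using * by (intro mult_mono) auto
    then show ?thesis by (simp add: mult_ac)
  qed
  then show ?case using * by (intro exI [of _ "norm v * C"] exI [of _ "Suc d"]) auto
qed

lemma gauss_polyfn_integrable:
  fixes f :: "'a::euclidean_space \<Rightarrow> 'b::{banach, second_countable_topology}"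
  assumes "polyfn f"
  shows "integrable lborel (\<lambda>y. gauss y *\<^sub>R f y)"
proof -
  obtain C d where *: "C \<ge> 0" "\<And>y. norm (f y) \<le> C * (1 + norm y) ^ d"
    using polyfn_bound [OF assms] by blast
  have [measurable]: "f \<in> borel_measurable borel"
    by (intro borel_measurable_continuous_onI polyfn_continuous assms)
  have "integrable lborel (\<lambda>y::'a. \<Sum>i\<le>d. (C * of_nat (d choose i)) * (gauss y * norm y ^ i))"
    by (intro Bochner_Integration.integrable_sum integrable_mult_right gauss_norm_power_integrable)
  moreover have "(\<Sum>i\<le>d. (C * of_nat (d choose i)) * (gauss y * norm y ^ i)) = gauss y * (C * (1 + norm y) ^ d)" for y :: 'a
    by (subst add.commute, subst binomial_ring) (simp add: sum_distrib_left mult_ac)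
  ultimately have "integrable lborel (\<lambda>y::'a. gauss y * (C * (1 + norm y) ^ d))"
    by simp
  then show ?thesis
    by (rule Bochner_Integration.integrable_bound)
      (use * in \<open>auto simp: gauss_def intro!: mult_left_mono order_trans [OF *(2)]\<close>)
qed

lemma lborel_integral_shift:
  fixes f :: "'a::euclidean_space \<Rightarrow> 'b::{banach, second_countable_topology}"
  assumes [measurable]: "f \<in> borel_measurable borel"
  shows "(LINT x|lborel. f (a + x)) = (LINT x|lborel. f x)"
    and "integrable lborel (\<lambda>x. f (a + x)) \<longleftrightarrow> integrable lborel f"
  using integral_distr [of "(+) a" lborel borel f] integrable_distr_eq [of "(+) a" lborel borel f]
  by (simp_all add: lborel_distr_plus)

text \<open>
  By translation invariance the integral of \<open>G (x + v) - G x\<close> vanishes. By the fundamental theorem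
  of calculus it is the integral of \<open>G'\<close> along the segments from \<open>x\<close> to \<open>x + v\<close>, and
  by Fubini and translation invariance once more this is the integral of \<open>G'\<close>.
\<close>

lemma integral_directional_derivative_zero:
  fixes G :: "'a::euclidean_space \<Rightarrow> 'b::euclidean_space"
  assumes deriv: "\<And>x t. ((\<lambda>t. G (x + t *\<^sub>R v)) has_vector_derivative G' (x + t *\<^sub>R v)) (at t)"
    and int: "integrable lborel G" "integrable lborel G'"
    and cont: "continuous_on UNIV G'"
  shows "(LINT x|lborel. G' x) = 0"
proof -
  have [measurable]: "G \<in> borel_measurable borel" "G' \<in> borel_measurable borel"
    using int by (auto dest: borel_measurable_integrable)
  let ?F = "\<lambda>(t::real) x. indicator {0..1} t *\<^sub>R G' (t *\<^sub>R v + x)"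
  have "integrable (lborel \<Otimes>\<^sub>M lborel) (\<lambda>(t, x). ?F t x)"
  proof (rule lborel_pair.Fubini_integrable)
    have "(\<lambda>t. LINT x|lborel. norm (case (t, x) of (t, x) \<Rightarrow> ?F t x))
      = (\<lambda>t. indicator {0..1} t *\<^sub>R (LINT x|lborel. norm (G' x)))"
      by (simp add: lborel_integral_shift(1) [of "\<lambda>x. norm (G' x)"])
    moreover have "integrable lborel (\<lambda>t::real. indicator {0..1} t *\<^sub>R (LINT x|lborel. norm (G' x)))"
      by (rule borel_integrable_compact) auto
    ultimately show "integrable lborel (\<lambda>t. LINT x|lborel. norm (case (t, x) of (t, x) \<Rightarrow> ?F t x))"
      by simp
    show "AE t in lborel. integrable lborel (\<lambda>x. case (t, x) of (t, x) \<Rightarrow> ?F t x)"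
      using int(2) by (simp add: lborel_integral_shift(2))
  qed (measurable)
  then have "(LINT x|lborel. LINT t|lborel. ?F t x) = (LINT t|lborel. LINT x|lborel. ?F t x)"
    by (rule lborel_pair.Fubini_integral)
  also have "\<dots> = (LINT t|lborel. indicator {0..1::real} t *\<^sub>R (LINT x|lborel. G' x))"
    by (simp add: lborel_integral_shift(1))
  also have "\<dots> = (LINT x|lborel. G' x)"
  proof -
    have "integrable lborel (indicator {0..1::real} :: real \<Rightarrow> real)"
      by (intro integrable_real_indicator) auto
    then show ?thesis
      by (simp add: Bochner_Integration.integral_scaleR_left [where f = "indicator {0..1::real} :: real \<Rightarrow> real"])
  qed
  also have "(\<lambda>x. LINT t|lborel. ?F t x) = (\<lambda>x. G (v + x) - G x)"
  proof
    fix x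
    have "(LINT t|lborel. indicator {0..1} t *\<^sub>R G' (x + t *\<^sub>R v)) = G (x + 1 *\<^sub>R v) - G (x + 0 *\<^sub>R v)"
    proof (rule integral_FTC_atLeastAtMost)
      show "((\<lambda>t. G (x + t *\<^sub>R v)) has_vector_derivative G' (x + t *\<^sub>R v)) (at t within {0..1})" for t
        by (rule has_vector_derivative_at_within [OF deriv])
      show "continuous_on {0..1} (\<lambda>t. G' (x + t *\<^sub>R v))"
        by (rule continuous_on_compose2 [OF cont]) (auto intro!: continuous_intros)
    qed simp
    then show "(LINT t|lborel. ?F t x) = G (v + x) - G x"
      by (simp add: add.commute)
  qed
  also have "(LINT x|lborel. G (v + x) - G x) = 0"
    using int by (subst Bochner_Integration.integral_diff) (auto simp: lborel_integral_shift)
  finally show ?thesis by simp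
qed

text \<open>
  The derivative of \<open>f exp(-|y|\<^sup>2)\<close> in the direction \<open>v\<close> integrates to zero.
\<close>

lemma gauss_integration_by_parts:
  fixes f :: "'a::euclidean_space \<Rightarrow> complex"
  assumes f: "polyfn f"
  shows "(LINT y|lborel. gauss y *\<^sub>R pd v f y) = 2 * (LINT y|lborel. gauss y *\<^sub>R ((y \<bullet> v) *\<^sub>R f y))"
proof -
  let ?g = "\<lambda>y. pd v f y + (-2) *\<^sub>R ((y \<bullet> v) *\<^sub>R f y)"
  have g: "polyfn ?g"
    by (intro polyfn.intros polyfn_scaleR polyfn_pd f)
  have "(LINT y|lborel. gauss y *\<^sub>R ?g y) = 0"
  proof (rule integral_directional_derivative_zero)
    fix x :: 'a and t :: real
    have 1: "((\<lambda>t. f (x + t *\<^sub>R v)) has_vector_derivative pd v f (x + t *\<^sub>R v)) (at t)"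
      unfolding has_vector_derivative_def
      by (rule has_derivative_eq_rhs, rule has_derivative_compose [OF _ polyfn_has_derivative [OF f]])
        (auto intro!: derivative_eq_intros ext simp: linear_scale [OF pd_linear [OF f]])
    have 2: "((\<lambda>t. gauss (x + t *\<^sub>R v)) has_real_derivative
        - 2 * ((x + t *\<^sub>R v) \<bullet> v) * gauss (x + t *\<^sub>R v)) (at t)"
      unfolding gauss_def inner_add_left inner_add_right inner_scaleR_left inner_scaleR_right
      by (auto intro!: derivative_eq_intros simp: inner_commute algebra_simps)
    show "((\<lambda>t. gauss (x + t *\<^sub>R v) *\<^sub>R f (x + t *\<^sub>R v)) has_vector_derivative
        gauss (x + t *\<^sub>R v) *\<^sub>R ?g (x + t *\<^sub>R v)) (at t)"
      using has_vector_derivative_scaleR [OF 2 1] by (simp add: algebra_simps)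
    show "integrable lborel (\<lambda>y. gauss y *\<^sub>R f y)" "integrable lborel (\<lambda>y. gauss y *\<^sub>R ?g y)"
      by (rule gauss_polyfn_integrable [OF f], rule gauss_polyfn_integrable [OF g])
    show "continuous_on UNIV (\<lambda>y. gauss y *\<^sub>R ?g y)"
      by (intro continuous_on_scaleR gauss_continuous polyfn_continuous [OF g])
  qed
  moreover have "(LINT y|lborel. gauss y *\<^sub>R ?g y) =
     (LINT y|lborel. gauss y *\<^sub>R pd v f y) + (-2) *\<^sub>R (LINT y|lborel. gauss y *\<^sub>R ((y \<bullet> v) *\<^sub>R f y))"
    by (simp only: scaleR_add_right scaleR_left_commute [of "gauss _" "-2"],
        subst Bochner_Integration.integral_add,
        rule gauss_polyfn_integrable [OF polyfn_pd [OF f]],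
        rule integrable_scaleR_right, rule gauss_polyfn_integrable [OF times_inner [OF f]],
        simp only: integral_scaleR_right)
  ultimately show ?thesis by (simp add: scaleR_conv_of_real)
qed

text \<open>
  Euler's identity writes \<open>k f(y)\<close> as \<open>\<Sum> y\<^sub>b \<partial>\<^sub>b f(y)\<close>, and
  integration by parts turns each \<open>y\<^sub>b\<close> into half a derivative, so that the integral becomes a
  multiple of that of the Laplacian.
\<close>

lemma gauss_integral_harmonic:
  fixes f :: "'a::euclidean_space \<Rightarrow> complex"
  assumes f: "polyfn f" and hom: "pos_homogeneous k f" and k: "k > 0"
    and harm: "\<And>x. laplacian f x = 0"
  shows "(LINT y|lborel. gauss y *\<^sub>R f y) = 0"
proof -
  have "real k *\<^sub>R (LINT y|lborel. gauss y *\<^sub>R f y) = (LINT y|lborel. gauss y *\<^sub>R pd y f y)"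
    by (simp add: euler_homogeneous [OF f hom] mult.commute flip: integral_scaleR_right)
  also have "\<dots> = (LINT y|lborel. (\<Sum>b\<in>Basis. gauss y *\<^sub>R ((y \<bullet> b) *\<^sub>R pd b f y)))"
    by (subst pd_expand [OF f]) (simp only: scaleR_sum_right)
  also have "\<dots> = (\<Sum>b\<in>Basis. LINT y|lborel. gauss y *\<^sub>R ((y \<bullet> b) *\<^sub>R pd b f y))"
    by (intro Bochner_Integration.integral_sum gauss_polyfn_integrable polyfn.intros polyfn_pd f)
  also have "2 * \<dots> = (\<Sum>b\<in>Basis. LINT y|lborel. gauss y *\<^sub>R pd b (pd b f) y)"
    by (simp only: sum_distrib_left gauss_integration_by_parts polyfn_pd f)
  also have "\<dots> = (LINT y|lborel. (\<Sum>b\<in>Basis. gauss y *\<^sub>R pd b (pd b f) y))"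
    by (intro Bochner_Integration.integral_sum [symmetric] gauss_polyfn_integrable polyfn_pd f)
  also have "\<dots> = 0"
    using harm by (simp add: laplacian_def flip: scaleR_sum_right)
  finally show ?thesis using k by simp
qed

lemma polyfn_power_inner: "polyfn f \<Longrightarrow> polyfn (\<lambda>y. (y \<bullet> x) ^ j *\<^sub>R f y)"
  by (induction j) (auto dest: times_inner [where v = x])

lemma pd_power_inner:
  assumes "polyfn f"
  shows "pd x (\<lambda>y. (y \<bullet> x) ^ j *\<^sub>R f y)
    = (\<lambda>y. (y \<bullet> x) ^ j *\<^sub>R pd x f y + (real j * (x \<bullet> x)) *\<^sub>R ((y \<bullet> x) ^ (j - 1) *\<^sub>R f y))"
proof (induction j)
  case (Suc j)
  have eq: "(\<lambda>y. (y \<bullet> x) ^ Suc j *\<^sub>R f y) = (\<lambda>y. (y \<bullet> x) *\<^sub>R ((y \<bullet> x) ^ j *\<^sub>R f y))"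
    by simp
  have lower: "(y \<bullet> x) *\<^sub>R ((real j * (x \<bullet> x)) *\<^sub>R ((y \<bullet> x) ^ (j - 1) *\<^sub>R f y))
      = (real j * (x \<bullet> x)) *\<^sub>R ((y \<bullet> x) ^ j *\<^sub>R f y)" for y
    by (cases j) (simp_all add: mult_ac)
  show ?case
    unfolding eq pd_times_inner [OF polyfn_power_inner [OF assms]] Suc scaleR_add_right lower
    by (rule ext) (simp add: algebra_simps)
qed auto

text \<open>
  The solution of the recursion for the Gaussian moments: for a harmonic \<open>f\<close> of degree \<open>k\<close>
  and \<open>q = |x|\<^sup>2\<close>, the mean of \<open>\<langle>x,y\<rangle>\<^sup>j f(y)\<close> under the normalised
  Gaussian is this multiple of \<open>f x\<close>. It vanishes unless \<open>j = k + 2 l\<close>.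
\<close>

definition moment_coeff :: "real \<Rightarrow> nat \<Rightarrow> nat \<Rightarrow> real" where
  "moment_coeff q k j = (if k \<le> j \<and> even (j - k)
     then fact j / (2 ^ j * fact ((j - k) div 2)) * q ^ ((j - k) div 2) else 0)"

lemma moment_coeff_eq: "moment_coeff q k (k + 2 * l) = fact (k + 2 * l) / (2 ^ (k + 2 * l) * fact l) * q ^ l"
  by (simp add: moment_coeff_def)

lemma moment_coeff_eq_0:
  assumes "\<And>l. j \<noteq> k + 2 * l"
  shows "moment_coeff q k j = 0"
proof -
  have "\<not> (k \<le> j \<and> even (j - k))"
  proof
    assume "k \<le> j \<and> even (j - k)"
    then have "even (j - k)" and kj: "k \<le> j" by blast+
    from this(1) obtain l where "j - k = 2 * l" by (rule evenE)
    with kj show False using assms [of l] by simp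
  qed
  then show ?thesis by (auto simp: moment_coeff_def)
qed

text \<open>
  The two terms correspond to differentiating \<open>f\<close> and to differentiating
  \<open>\<langle>x,y\<rangle>\<^sup>j\<close>. At \<open>j = 0\<close> the truncated \<open>j - 1\<close> is harmless because of
  the factor \<open>real j\<close>.
\<close>

lemma moment_coeff_rec:
  "2 * moment_coeff q k (Suc j) =
     (if k = 0 then 0 else real k * moment_coeff q (k - 1) j) + real j * q * moment_coeff q k (j - 1)"
proof (cases "\<exists>l. Suc j = k + 2 * l")
  case True
  then obtain l where l: "Suc j = k + 2 * l" by blast
  show ?thesis
  proof (cases l)
    case 0
    then show ?thesis using l by (auto simp: moment_coeff_def)
  next
    case (Suc i)
    define n where "n = k + 2 * i"
    \<comment> \<open>all three coefficients are rational multiples of \<open>X\<close>\<close>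
    define X where "X = fact n / (2 ^ n * fact i) * q ^ Suc i"
    have k: "real k = real n - 2 * real i" by (simp add: n_def)
    have j: "j = Suc n" using l Suc by (simp add: n_def)
    have "moment_coeff q k (k + 2 * l) = (real n + 2) * (real n + 1) / (4 * (real i + 1)) * X"
      unfolding moment_coeff_eq using Suc by (simp add: X_def n_def divide_simps add_ac)
    moreover have "moment_coeff q (k - 1) (k - 1 + 2 * l) = (real n + 1) / (2 * (real i + 1)) * X" if "k > 0"
    proof -
      have n: "k - 1 + 2 * l = Suc n" using that Suc by (simp add: n_def)
      have "moment_coeff q (k - 1) (k - 1 + 2 * l) = fact (Suc n) / (2 ^ Suc n * fact (Suc i)) * q ^ Suc i"
        using moment_coeff_eq [of q "k - 1" l] unfolding n unfolding Suc .
      then show ?thesis by (simp add: X_def divide_simps) (simp add: algebra_simps)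
    qed
    moreover have "q * moment_coeff q k (k + 2 * i) = X"
      unfolding moment_coeff_eq by (simp add: X_def n_def)
    moreover have "k + 2 * l = Suc j" "k + 2 * i = j - 1" "k > 0 \<Longrightarrow> k - 1 + 2 * l = j"
      using l Suc by auto
    moreover have "2 * ((real n + 2) * (real n + 1) / (4 * (real i + 1)) * X)
        = real k * ((real n + 1) / (2 * (real i + 1)) * X) + real j * X"
      unfolding k j by (simp add: divide_simps) (simp add: algebra_simps)
    ultimately show ?thesis
      by (cases "k = 0") (simp_all add: mult.assoc)
  qed
next
  case False
  have "moment_coeff q k (Suc j) = 0"
    using False by (intro moment_coeff_eq_0) blast
  moreover have "moment_coeff q (k - 1) j = 0" if "k \<noteq> 0"
  proof (intro moment_coeff_eq_0 notI)
    fix l assume "j = k - 1 + 2 * l"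
    then have "Suc j = k + 2 * l" using that by simp
    with False show False by blast
  qed
  moreover have "moment_coeff q k (j - 1) = 0" if "j \<noteq> 0"
  proof (intro moment_coeff_eq_0 notI)
    fix l assume "j - 1 = k + 2 * l"
    then have "Suc j = k + 2 * Suc l" using that by simp
    with False show False by blast
  qed
  ultimately show ?thesis by auto
qed

text \<open>
  Integrating by parts in the direction \<open>x\<close> removes one factor \<open>\<langle>x,y\<rangle>\<close> and either
  differentiates \<open>f\<close>, lowering its degree while keeping it harmonic, or removes a second factor
  \<open>\<langle>x,y\<rangle>\<close> at the price of \<open>|x|\<^sup>2\<close>. Since
  \<open>\<partial>\<^sub>x f(x) = k f(x)\<close>, the induction hypothesis expresses both terms through \<open>f x\<close>.
\<close>

lemma gauss_moment_harmonic:
  fixes f :: "'a::euclidean_space \<Rightarrow> complex"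
  assumes "polyfn f" "pos_homogeneous k f" "\<And>x. laplacian f x = 0"
  shows "(LINT y|lborel. gauss y *\<^sub>R ((y \<bullet> x) ^ j *\<^sub>R f y))
    = of_real ((LINT y::'a|lborel. gauss y) * moment_coeff (x \<bullet> x) k j) * f x"
  using assms
proof (induction j arbitrary: k f rule: less_induct)
  case (less j)
  let ?G = "LINT y::'a|lborel. gauss y"
  have zero: "(LINT y|lborel. gauss y *\<^sub>R f y) = of_real ?G * f x" if "k = 0"
  proof -
    have "pos_homogeneous 0 f" using less.prems(2) that by simp
    then have "f y = f x" for y using homogeneous_0_const [OF less.prems(1)] by metis
    then have "(\<lambda>y. gauss y *\<^sub>R f y) = (\<lambda>y. gauss y *\<^sub>R f x)"
      by (intro ext arg_cong2 [where f = scaleR] refl)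
    then have "(LINT y|lborel. gauss y *\<^sub>R f y) = (LINT y::'a|lborel. gauss y *\<^sub>R f x)"
      by (simp only:)
    then show ?thesis
      using gauss_polyfn_integrable [of "\<lambda>_. 1::real"]
      by (simp add: scaleR_conv_of_real polyfn.const)
  qed
  show ?case
  proof (cases j)
    case 0
    show ?thesis
    proof (cases "k = 0")
      case True
      then show ?thesis using 0 zero by (simp add: moment_coeff_def)
    next
      case False
      then show ?thesis using 0 gauss_integral_harmonic [OF less.prems(1,2) _ less.prems(3)]
        by (simp add: moment_coeff_def)
    qed
  next
    case (Suc i)
    note f = less.prems(1)
    let ?M = "\<lambda>j f. LINT y|lborel. gauss y *\<^sub>R ((y \<bullet> x) ^ j *\<^sub>R f y)"
    have "2 * ?M j f = 2 * (LINT y|lborel. gauss y *\<^sub>R ((y \<bullet> x) *\<^sub>R ((y \<bullet> x) ^ i *\<^sub>R f y)))"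
      by (simp add: Suc mult.assoc)
    also have "\<dots> = (LINT y|lborel. gauss y *\<^sub>R pd x (\<lambda>y. (y \<bullet> x) ^ i *\<^sub>R f y) y)"
      by (rule gauss_integration_by_parts [symmetric, OF polyfn_power_inner [OF f]])
    also have "\<dots> = (LINT y|lborel. gauss y *\<^sub>R ((y \<bullet> x) ^ i *\<^sub>R pd x f y) +
        (real i * (x \<bullet> x)) *\<^sub>R (gauss y *\<^sub>R ((y \<bullet> x) ^ (i - 1) *\<^sub>R f y)))"
      by (subst pd_power_inner [OF f]) (simp only: scaleR_add_right scaleR_left_commute)
    also have "\<dots> = ?M i (pd x f) + (real i * (x \<bullet> x)) *\<^sub>R ?M (i - 1) f"
      by (subst Bochner_Integration.integral_add, intro gauss_polyfn_integrable polyfn_power_inner polyfn_pd f,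
          intro integrable_scaleR_right gauss_polyfn_integrable polyfn_power_inner f)
        (simp only: integral_scaleR_right)
    also have "?M (i - 1) f = of_real (?G * moment_coeff (x \<bullet> x) k (i - 1)) * f x"
      using Suc by (intro less.IH less.prems) auto
    also have "?M i (pd x f) = of_real (?G * (if k = 0 then 0 else real k * moment_coeff (x \<bullet> x) (k - 1) i)) * f x"
    proof (cases k)
      case 0
      have "pos_homogeneous 0 f" using less.prems(2) 0 by simp
      then have "f = (\<lambda>_. f 0)" using homogeneous_0_const [OF f] by (intro ext)
      then have "pd x f = (\<lambda>_. 0)" using pd_const [of x "f 0"] by simp
      then show ?thesis using 0 by simp
    next
      case (Suc k')
      have "?M i (pd x f) = of_real (?G * moment_coeff (x \<bullet> x) k' i) * pd x f x"
      proof (intro less.IH)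
        show "i < j" using \<open>j = Suc i\<close> by simp
        show "pos_homogeneous k' (pd x f)"
          using less.prems(2) unfolding Suc by (intro pd_homogeneous f)
      qed (auto intro: polyfn_pd f laplacian_pd less.prems)
      then show ?thesis
        using Suc by (simp add: euler_homogeneous [OF less.prems(1,2)] scaleR_conv_of_real mult_ac)
    qed
    also have "of_real (?G * (if k = 0 then 0 else real k * moment_coeff (x \<bullet> x) (k - 1) i)) * f x
        + (real i * (x \<bullet> x)) *\<^sub>R (of_real (?G * moment_coeff (x \<bullet> x) k (i - 1)) * f x)
      = of_real (?G * (2 * moment_coeff (x \<bullet> x) k (Suc i))) * f x"
      unfolding moment_coeff_rec by (simp add: scaleR_conv_of_real algebra_simps)
    finally show ?thesis by (simp add: Suc)
  qed
qed

lemma pos_homogeneous_power_inner: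
  fixes f :: "'a::euclidean_space \<Rightarrow> 'b::real_vector"
  assumes "pos_homogeneous k f"
  shows "pos_homogeneous (k + j) (\<lambda>y. (y \<bullet> x) ^ j *\<^sub>R f y)"
  unfolding pos_homogeneous_def
proof (intro allI impI)
  fix t :: real and y :: 'a assume "t > 0"
  then have "f (t *\<^sub>R y) = t ^ k *\<^sub>R f y"
    by (rule pos_homogeneousD [OF assms])
  then show "((t *\<^sub>R y) \<bullet> x) ^ j *\<^sub>R f (t *\<^sub>R y) = t ^ (k + j) *\<^sub>R (y \<bullet> x) ^ j *\<^sub>R f y"
    by (simp add: power_mult_distrib power_add mult_ac)
qed

lemma sphere_integral_gauss:
  fixes h :: "'a::euclidean_space \<Rightarrow> complex"
  assumes "polyfn h" "pos_homogeneous d h"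
  shows "(LINT y|lborel. gauss y *\<^sub>R h y)
    = sphere_integral d h * of_real (Gamma (real (DIM('a) + d) / 2) / 2)"
proof -
  have "(LINT y|lborel. complex_of_real (exp (- (norm y)\<^sup>2)) * h y) = sphere_integral d h *
      (LINT r:{0..}|lborel. of_real (r ^ (DIM('a) + d - 1)) * of_real (exp (- r\<^sup>2)))"
    using gauss_polyfn_integrable [OF assms(1)]
    by (intro polar_integral [where f = "\<lambda>r. of_real (exp (- r\<^sup>2))"] polyfn_continuous assms)
      (auto simp: scaleR_conv_of_real gauss_norm)
  moreover have "real (DIM('a) + d - 1) + 1 = real (DIM('a) + d)"
    using DIM_positive [where 'a = 'a] by linarith
  ultimately show ?thesis
    by (simp add: gaussian_radial_integral scaleR_conv_of_real gauss_norm del: of_real_power)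
qed

text \<open>
  Polar coordinates for the constant function reduce this to the volume of the unit ball.
\<close>

lemma gauss_integral: "(LINT y::'a::euclidean_space|lborel. gauss y) = pi powr (real DIM('a) / 2)"
proof -
  let ?n = "real DIM('a)"
  have n: "?n > 0" by simp
  have "complex_of_real (LINT y::'a|lborel. gauss y) = (LINT y::'a|lborel. gauss y *\<^sub>R (1::complex))"
    by (simp add: scaleR_conv_of_real)
  also have "\<dots> = sphere_integral 0 (\<lambda>_::'a. 1::complex) * of_real (Gamma (?n / 2) / 2)"
    by (subst sphere_integral_gauss [where d = 0]) (auto intro: polyfn.const simp: pos_homogeneous_def)
  also have "sphere_integral 0 (\<lambda>_::'a. 1::complex) = of_real (?n * unit_ball_vol ?n)"
    by (simp add: sphere_integral_def set_lebesgue_integral_def scaleR_conv_of_real content_cball)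
  also have "complex_of_real (?n * unit_ball_vol ?n) * of_real (Gamma (?n / 2) / 2) = of_real (pi powr (?n / 2))"
  proof -
    define g where "g = Gamma (?n / 2)"
    have "Gamma (?n / 2 + 1) = ?n / 2 * g"
      using n unfolding g_def by (intro Gamma_plus1) (auto dest: nonpos_Ints_nonpos)
    moreover have "g > 0" using n unfolding g_def by (intro Gamma_real_pos) auto
    ultimately show ?thesis using n
      unfolding unit_ball_vol_def g_def [symmetric] of_real_mult [symmetric] of_real_eq_iff by simp
  qed
  finally show ?thesis
    by (simp only: of_real_eq_iff)
qed

text \<open>
  The Gaussian moments divided by the radial Gaussian moment of degree \<open>k + j\<close>. This is where the
  factor \<open>rGamma\<close> of the Bessel series arises.
\<close>

lemma sphere_integral_harmonic:
  fixes f :: "'a::euclidean_space \<Rightarrow> complex"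
  assumes "polyfn f" "pos_homogeneous k f" "\<And>x. laplacian f x = 0"
  shows "sphere_integral (k + j) (\<lambda>y. (y \<bullet> x) ^ j *\<^sub>R f y)
    = of_real (2 * pi powr (real DIM('a) / 2) * moment_coeff (x \<bullet> x) k j * rGamma (real (DIM('a) + (k + j)) / 2)) * f x"
proof -
  have pos: "Gamma (real (DIM('a) + (k + j)) / 2) > 0"
    by (intro Gamma_real_pos) (simp add: add_pos_nonneg)
  have "sphere_integral (k + j) (\<lambda>y. (y \<bullet> x) ^ j *\<^sub>R f y) * of_real (Gamma (real (DIM('a) + (k + j)) / 2) / 2)
    = of_real (pi powr (real DIM('a) / 2) * moment_coeff (x \<bullet> x) k j) * f x"
    using sphere_integral_gauss [OF polyfn_power_inner [OF assms(1)] pos_homogeneous_power_inner [OF assms(2)], of x j]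
    by (simp only: gauss_moment_harmonic [OF assms] gauss_integral)
  then show ?thesis
    using pos by (simp add: rGamma_inverse_Gamma field_simps)
qed

section \<open>The Fourier and the Hankel transform as moment series\<close>

lemma sums_integral_dominated:
  fixes f :: "nat \<Rightarrow> 'a \<Rightarrow> 'b::{banach, second_countable_topology}"
  assumes meas [measurable]: "\<And>i. f i \<in> borel_measurable M"
    and b: "integrable M b" and a: "summable a"
    and bound: "\<And>i x. norm (f i x) \<le> a i * b x"
  shows "integrable M (\<lambda>x. \<Sum>i. f i x)"
    and "(\<lambda>i. integral\<^sup>L M (f i)) sums (LINT x|M. (\<Sum>i. f i x))"
proof -
  have int: "integrable M (f i)" for i
    by (rule Bochner_Integration.integrable_bound [OF integrable_mult_right [OF b, of "a i"]])
      (auto intro!: order_trans [OF bound])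
  have sum: "summable (\<lambda>i. norm (f i x))" for x
    by (rule summable_comparison_test' [OF summable_mult2 [OF a, of "b x"]]) (use bound in auto)
  have sum': "summable (\<lambda>i. LINT x|M. norm (f i x))"
  proof (rule summable_comparison_test' [OF summable_mult2 [OF a, of "LINT x|M. b x"]])
    fix i
    have "(LINT x|M. norm (f i x)) \<le> (LINT x|M. a i * b x)"
      by (intro integral_mono integrable_norm int integrable_mult_right b bound)
    then show "norm (LINT x|M. norm (f i x)) \<le> a i * (LINT x|M. b x)"
      by simp
  qed
  show "integrable M (\<lambda>x. \<Sum>i. f i x)"
    using int sum sum' by (intro integrable_suminf) auto
  show "(\<lambda>i. integral\<^sup>L M (f i)) sums (LINT x|M. (\<Sum>i. f i x))"
    using int sum sum' by (intro sums_integral) auto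
qed

lemma fourier_moment_series:
  fixes F :: "'a::euclidean_space \<Rightarrow> complex"
  assumes cont: "continuous_on (cball 0 1) F"
  shows "(\<lambda>j. (2 * of_real pi * \<i> * of_real c) ^ j / fact j * (LINT y:cball 0 1|lborel. (y \<bullet> x) ^ j *\<^sub>R F y))
    sums (LINT y:cball 0 1|lborel. exp (2 * of_real pi * \<i> * of_real (c * (x \<bullet> y))) * F y)"
proof -
  let ?w = "2 * of_real pi * \<i> * of_real c :: complex"
  let ?I = "indicator (cball 0 1) :: 'a \<Rightarrow> real"
  define f where "f j y = ?I y *\<^sub>R ((?w * of_real (y \<bullet> x)) ^ j /\<^sub>R fact j * F y)" for j y
  have [measurable]: "(\<lambda>y. ?I y *\<^sub>R F y) \<in> borel_measurable borel"
    using borel_measurable_continuous_on_indicator [OF _ cont] by auto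
  have int: "integrable lborel (\<lambda>y. ?I y *\<^sub>R F y)"
    using set_integrable_cball [OF cont] by (simp add: set_integrable_def)
  have f_eq: "f j y = (?w * of_real (y \<bullet> x)) ^ j /\<^sub>R fact j * (?I y *\<^sub>R F y)" for j y
    by (simp add: f_def)
  have "(\<lambda>j. integral\<^sup>L lborel (f j)) sums (LINT y|lborel. (\<Sum>j. f j y))"
  proof (rule sums_integral_dominated)
    show "f j \<in> borel_measurable lborel" for j
      unfolding f_eq [abs_def] by measurable
    show "integrable lborel (\<lambda>y. norm (?I y *\<^sub>R F y))"
      by (rule integrable_norm [OF int])
    show "summable (\<lambda>j. (norm ?w * norm x) ^ j /\<^sub>R fact j)"
      using sums_summable [OF exp_converges] .
    show "norm (f j y) \<le> (norm ?w * norm x) ^ j /\<^sub>R fact j * norm (?I y *\<^sub>R F y)" for j y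
    proof (cases "y \<in> cball 0 1")
      case True
      have "\<bar>y \<bullet> x\<bar> \<le> norm y * norm x"
        by (rule Cauchy_Schwarz_ineq2)
      also have "\<dots> \<le> 1 * norm x"
        using True by (intro mult_right_mono) auto
      finally have "norm (?w * of_real (y \<bullet> x)) \<le> norm ?w * norm x"
        unfolding norm_mult by (intro mult_left_mono) auto
      then have "norm (?w * of_real (y \<bullet> x)) ^ j \<le> (norm ?w * norm x) ^ j"
        by (intro power_mono) auto
      then have "norm ((?w * of_real (y \<bullet> x)) ^ j /\<^sub>R fact j) \<le> (norm ?w * norm x) ^ j /\<^sub>R fact j"
        by (simp only: norm_scaleR norm_power real_scaleR_def) (simp add: divide_simps del: norm_mult)
      then show ?thesis
        unfolding f_eq norm_mult [of _ "?I y *\<^sub>R F y"] by (intro mult_right_mono) auto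
    qed (simp add: f_def)
  qed
  also have "(\<lambda>j. integral\<^sup>L lborel (f j))
      = (\<lambda>j. ?w ^ j / fact j * (LINT y:cball 0 1|lborel. (y \<bullet> x) ^ j *\<^sub>R F y))"
    unfolding set_lebesgue_integral_def f_def integral_mult_right_zero [symmetric]
    by (intro ext Bochner_Integration.integral_cong) (auto simp: power_mult_distrib scaleR_conv_of_real field_simps)
  also have "(\<lambda>y. \<Sum>j. f j y) = (\<lambda>y. ?I y *\<^sub>R (exp (2 * of_real pi * \<i> * of_real (c * (x \<bullet> y))) * F y))"
  proof
    fix y
    have "(\<lambda>j. f j y) sums (exp (?w * of_real (y \<bullet> x)) * (?I y *\<^sub>R F y))"
      unfolding f_eq by (intro sums_mult2 exp_converges)
    then show "(\<Sum>j. f j y) = ?I y *\<^sub>R (exp (2 * of_real pi * \<i> * of_real (c * (x \<bullet> y))) * F y)"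
      by (simp add: sums_iff inner_commute mult_ac)
  qed
  finally show ?thesis by (simp add: set_lebesgue_integral_def)
qed

text \<open>
  The profile is truncated to \<open>{0<..1}\<close> because nothing is known of \<open>G\<close> beyond \<open>1\<close>, and
  near \<open>0\<close> continuity of the product does not control it where \<open>H\<close> vanishes.
\<close>

lemma cball_moment_polar:
  fixes H :: "'a::euclidean_space \<Rightarrow> complex" and G :: "real \<Rightarrow> complex"
  assumes H: "polyfn H" "pos_homogeneous k H"
    and cont: "continuous_on (cball 0 1) (\<lambda>y. G ((norm y)\<^sup>2) * H y)"
    and meas [measurable]: "(\<lambda>r. indicator {0<..1} r *\<^sub>R G (r\<^sup>2)) \<in> borel_measurable borel"
  shows "(LINT y:cball 0 1|lborel. (y \<bullet> x) ^ j *\<^sub>R (G ((norm y)\<^sup>2) * H y))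
    = sphere_integral (k + j) (\<lambda>y. (y \<bullet> x) ^ j *\<^sub>R H y) *
      (LINT r:{0<..<1}|lborel. of_real (r ^ (DIM('a) + (k + j) - 1)) * G (r\<^sup>2))"
proof -
  let ?g = "\<lambda>r. indicator {0<..1} r *\<^sub>R G (r\<^sup>2)"
  let ?h = "\<lambda>y. (y \<bullet> x) ^ j *\<^sub>R H y"
  let ?F = "\<lambda>y. indicator (cball 0 1) y *\<^sub>R ((y \<bullet> x) ^ j *\<^sub>R (G ((norm y)\<^sup>2) * H y))"
  have contH: "continuous_on UNIV ?h"
    by (intro polyfn_continuous polyfn_power_inner H)
  then have [measurable]: "?h \<in> borel_measurable borel"
    by (rule borel_measurable_continuous_onI)
  have cF: "continuous_on (cball 0 1) (\<lambda>y. (y \<bullet> x) ^ j *\<^sub>R (G ((norm y)\<^sup>2) * H y))"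
    by (intro continuous_on_scaleR cont continuous_intros)
  have intF: "integrable lborel ?F"
    using set_integrable_cball [OF cF] by (simp add: set_integrable_def)
  have gh [measurable]: "(\<lambda>y. ?g (norm y) * ?h y) \<in> borel_measurable lborel"
    by measurable
  have [measurable]: "?F \<in> borel_measurable lborel"
    using intF by (auto dest: borel_measurable_integrable)
  have AE: "AE y in lborel. ?F y = ?g (norm y) * ?h y"
    using AE_lborel_singleton [of "0::'a"] by eventually_elim (auto simp: indicator_def)
  have "(LINT y:cball 0 1|lborel. (y \<bullet> x) ^ j *\<^sub>R (G ((norm y)\<^sup>2) * H y)) = (LINT y|lborel. ?g (norm y) * ?h y)"
    unfolding set_lebesgue_integral_def by (rule integral_cong_AE [OF _ _ AE]) measurable
  also have "\<dots> = sphere_integral (k + j) ?h * (LINT r:{0..}|lborel. of_real (r ^ (DIM('a) + (k + j) - 1)) * ?g r)"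
  proof (rule polar_integral [OF contH pos_homogeneous_power_inner [OF H(2)] meas])
    show "integrable lborel (\<lambda>y. ?g (norm y) * ?h y)"
      using intF gh by (rule Bochner_Integration.integrable_cong_AE_imp) (use AE in \<open>elim eventually_mono, simp only:\<close>)
  qed
  also have "(LINT r:{0..}|lborel. of_real (r ^ (DIM('a) + (k + j) - 1)) * ?g r)
     = (LINT r:{0<..<1}|lborel. of_real (r ^ (DIM('a) + (k + j) - 1)) * G (r\<^sup>2))"
  proof -
    let ?p = "\<lambda>r. complex_of_real (r ^ (DIM('a) + (k + j) - 1))"
    have 1: "(\<lambda>r. indicator {0..} r *\<^sub>R (?p r * ?g r)) \<in> borel_measurable lborel"
      by measurable
    have "(\<lambda>r. indicator {0<..<1} r *\<^sub>R (?p r * ?g r)) \<in> borel_measurable lborel"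
      by measurable
    also have "(\<lambda>r. indicator {0<..<1} r *\<^sub>R (?p r * ?g r)) = (\<lambda>r. indicator {0<..<1} r *\<^sub>R (?p r * G (r\<^sup>2)))"
      by (auto simp: indicator_def)
    finally have 2: "\<dots> \<in> borel_measurable lborel" .
    have "AE r in lborel. indicator {0..} r *\<^sub>R (?p r * ?g r) = indicator {0<..<1} r *\<^sub>R (?p r * G (r\<^sup>2))"
      using AE_lborel_singleton [of "1::real"] by eventually_elim (auto simp: indicator_def)
    then show ?thesis
      unfolding set_lebesgue_integral_def by (rule integral_cong_AE [OF 1 2])
  qed
  finally show ?thesis .
qed

text \<open>
  The coefficients of \<open>J\<^sub>\<alpha>(2 z) = \<Sum> bessel_coeff \<alpha> l z\<^bsup>2 l + \<alpha>\<^esup>\<close>.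
\<close>

definition bessel_coeff :: "real \<Rightarrow> nat \<Rightarrow> real" where
  "bessel_coeff \<alpha> l = (- 1) ^ l / fact l * rGamma (real l + \<alpha> + 1)"

text \<open>
  By the functional equation each step divides by \<open>l + \<beta>\<close>. This is at least \<open>1\<close> except
  possibly at \<open>l = 0\<close>, where it is at least \<open>1/2\<close>; hence the constant \<open>2\<close>. The
  smallest \<open>\<beta>\<close> that occurs is \<open>1/2\<close>, for \<open>k = 0\<close> in dimension one.
\<close>

lemma rGamma_shift_bounded:
  fixes \<beta> :: real
  assumes "\<beta> \<ge> 1 / 2"
  shows "\<bar>rGamma (real l + \<beta>)\<bar> \<le> 2 * \<bar>rGamma \<beta>\<bar>"
proof (induction l)
  case (Suc l)
  have "\<bar>rGamma (real l + \<beta>)\<bar> = (real l + \<beta>) * \<bar>rGamma (real (Suc l) + \<beta>)\<bar>"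
    using assms by (subst rGamma_plus1 [symmetric]) (simp add: abs_mult add_ac)
  show ?case
  proof (cases l)
    case 0
    then have "\<bar>rGamma \<beta>\<bar> = \<beta> * \<bar>rGamma (1 + \<beta>)\<bar>"
      using \<open>\<bar>rGamma (real l + \<beta>)\<bar> = _\<close> by simp
    moreover have "1 / 2 * \<bar>rGamma (1 + \<beta>)\<bar> \<le> \<beta> * \<bar>rGamma (1 + \<beta>)\<bar>"
      using assms by (intro mult_right_mono) auto
    ultimately show ?thesis using 0 by simp
  next
    case (Suc i)
    have "1 * \<bar>rGamma (real (Suc l) + \<beta>)\<bar> \<le> (real l + \<beta>) * \<bar>rGamma (real (Suc l) + \<beta>)\<bar>"
      using assms Suc by (intro mult_right_mono) auto
    then show ?thesis
      using Suc.IH \<open>\<bar>rGamma (real l + \<beta>)\<bar> = _\<close> by linarith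
  qed
qed simp

lemma bessel_coeff_summable:
  assumes "\<alpha> \<ge> - 1 / 2"
  shows "summable (\<lambda>l. \<bar>bessel_coeff \<alpha> l\<bar> * z ^ (2 * l))"
proof -
  have "summable (\<lambda>l. (2 * \<bar>rGamma (\<alpha> + 1)\<bar>) * (inverse (fact l) * (z\<^sup>2) ^ l))"
    by (intro summable_mult summable_exp)
  then show ?thesis
  proof (rule summable_comparison_test')
    fix l
    have "\<bar>rGamma (real l + (\<alpha> + 1))\<bar> \<le> 2 * \<bar>rGamma (\<alpha> + 1)\<bar>"
      using assms by (intro rGamma_shift_bounded) auto
    then have "\<bar>rGamma (real l + (\<alpha> + 1))\<bar> * (inverse (fact l) * (z\<^sup>2) ^ l)
        \<le> 2 * \<bar>rGamma (\<alpha> + 1)\<bar> * (inverse (fact l) * (z\<^sup>2) ^ l)"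
      by (intro mult_right_mono) auto
    then show "norm (\<bar>bessel_coeff \<alpha> l\<bar> * z ^ (2 * l)) \<le> 2 * \<bar>rGamma (\<alpha> + 1)\<bar> * (inverse (fact l) * (z\<^sup>2) ^ l)"
      unfolding bessel_coeff_def power_mult [of z]
      by (simp add: abs_mult divide_inverse mult_ac add_ac)
  qed
qed

lemma bessel_J_sums:
  assumes "\<alpha> \<ge> - 1 / 2" "z > 0"
  shows "(\<lambda>l. bessel_coeff \<alpha> l * z ^ (2 * l) * z powr \<alpha>) sums bessel_J \<alpha> (2 * z)"
proof -
  have eq: "bessel_coeff \<alpha> l * z ^ (2 * l) * z powr \<alpha>
    = (- 1) ^ l / fact l * rGamma (real l + \<alpha> + 1) * (2 * z / 2) powr (2 * real l + \<alpha>)" for l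
    using assms(2) powr_realpow [of z "2 * l"] by (simp add: bessel_coeff_def powr_add)
  have "summable (\<lambda>l. bessel_coeff \<alpha> l * z ^ (2 * l))"
    by (rule summable_rabs_cancel) (use bessel_coeff_summable [OF assms(1), of z] in \<open>simp add: abs_mult power_abs power_mult\<close>)
  then have "summable (\<lambda>l. bessel_coeff \<alpha> l * z ^ (2 * l) * z powr \<alpha>)"
    by (rule summable_mult2)
  then show ?thesis
    unfolding bessel_J_def eq by (rule summable_sums)
qed

text \<open>
  The half-integral powers of \<open>y\<close> coming from the square root, the Bessel function and the
  profile combine to the integral power \<open>n + 2 k + 2 l - 1\<close>, written here in the form in which it
  occurs in the polar moments.
\<close>

lemma hankel_kernel_term:
  fixes n k :: nat
  assumes "c > 0" "s > 0" "y > 0" "n > 0"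
  defines "\<alpha> \<equiv> real k + real n / 2 - 1"
  shows "sqrt (2 * pi * c * s * y) * (z * (pi * c * s * y) ^ (2 * l) * (pi * c * s * y) powr \<alpha>)
      * y powr (real k + (real n - 1) / 2)
    = sqrt (2 * pi * c * s) * (pi * c * s) powr \<alpha> * (z * (pi * c * s) ^ (2 * l)) * y ^ (n + (k + (k + 2 * l)) - 1)"
proof -
  have "y ^ (n + (k + (k + 2 * l)) - 1) = y powr real (n + (k + (k + 2 * l)) - 1)"
    using assms(3) powr_realpow [of y "n + (k + (k + 2 * l)) - 1"] by simp
  also have "real (n + (k + (k + 2 * l)) - 1) = 1 / 2 + (real (2 * l) + (\<alpha> + (real k + (real n - 1) / 2)))"
    using assms(4) by (simp add: \<alpha>_def of_nat_diff field_simps)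
  also have "y powr \<dots> = sqrt y * (y ^ (2 * l) * (y powr \<alpha> * y powr (real k + (real n - 1) / 2)))"
    using assms by (simp only: powr_add powr_realpow powr_half_sqrt less_imp_le)
  finally have *: "y ^ (n + (k + (k + 2 * l)) - 1) = \<dots>" .
  show ?thesis
    unfolding * using assms by (simp add: powr_mult real_sqrt_mult power_mult_distrib mult_ac)
qed

text \<open>
  Integrating the Bessel series termwise expresses the Hankel transform through the same radial moments
  as the Fourier transform. The bound on \<open>r\<^sup>k G(r\<^sup>2)\<close> makes the series of integrands
  dominated by the absolutely convergent Bessel series at \<open>z = \<pi> c s\<close>.
\<close>

lemma hankel_transform_series:
  fixes G :: "real \<Rightarrow> complex" and n k :: nat
  assumes c: "c > 0" and s: "s > 0" and n: "n > 0"
    and meas: "(\<lambda>r. indicator {0<..1} r *\<^sub>R G (r\<^sup>2)) \<in> borel_measurable borel"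
    and bound: "\<And>r. 0 < r \<Longrightarrow> r < 1 \<Longrightarrow> norm (of_real (r ^ k) * G (r\<^sup>2)) \<le> M"
  defines "\<alpha> \<equiv> real k + real n / 2 - 1"
    and "\<phi> \<equiv> \<lambda>r. complex_of_real (r powr (real k + (real n - 1) / 2)) * G (r\<^sup>2)"
  shows "set_integrable lborel {0<..<1} (\<lambda>y. of_real (hankel_kernel c \<alpha> s y) * \<phi> y)"
    and "(\<lambda>l. of_real (sqrt (2 * pi) * sqrt (2 * pi * c * s) * (pi * c * s) powr \<alpha> * (bessel_coeff \<alpha> l * (pi * c * s) ^ (2 * l))) *
          (LINT r:{0<..<1}|lborel. of_real (r ^ (n + (k + (k + 2 * l)) - 1)) * G (r\<^sup>2)))
       sums finite_hankel c \<alpha> \<phi> s"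
proof -
  let ?z = "pi * c * s"
  let ?K = "sqrt (2 * pi * c * s) * ?z powr \<alpha>"
  let ?I = "indicator {0<..<1} :: real \<Rightarrow> real"
  let ?e = "\<lambda>l. n + (k + (k + 2 * l)) - 1"
  have \<alpha>: "\<alpha> \<ge> - 1 / 2" using n by (simp add: \<alpha>_def)
  have z: "?z > 0" using c s by simp
  define f where "f l y = ?I y *\<^sub>R (of_real (?K * (bessel_coeff \<alpha> l * ?z ^ (2 * l)) * y ^ ?e l) * G (y\<^sup>2))" for l y
  have fsum: "(\<lambda>l. f l y) sums (?I y *\<^sub>R (of_real (hankel_kernel c \<alpha> s y) * \<phi> y))" for y
  proof (cases "y \<in> {0<..<1}")
    case True
    then have y: "y > 0" by simp
    have "(\<lambda>l. of_real (sqrt (2 * pi * c * s * y) * (bessel_coeff \<alpha> l * (?z * y) ^ (2 * l) * (?z * y) powr \<alpha>) * y powr (real k + (real n - 1) / 2)) * G (y\<^sup>2))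
      sums (of_real (sqrt (2 * pi * c * s * y) * bessel_J \<alpha> (2 * (?z * y)) * y powr (real k + (real n - 1) / 2)) * G (y\<^sup>2))"
      using z y by (intro sums_mult2 sums_of_real sums_mult bessel_J_sums \<alpha>) simp
    also have "(\<lambda>l. of_real (sqrt (2 * pi * c * s * y) * (bessel_coeff \<alpha> l * (?z * y) ^ (2 * l) * (?z * y) powr \<alpha>) * y powr (real k + (real n - 1) / 2)) * G (y\<^sup>2))
      = (\<lambda>l. f l y)"
      unfolding \<alpha>_def hankel_kernel_term [OF c s y n] f_def using True by simp
    also have "of_real (sqrt (2 * pi * c * s * y) * bessel_J \<alpha> (2 * (?z * y)) * y powr (real k + (real n - 1) / 2)) * G (y\<^sup>2)
      = ?I y *\<^sub>R (of_real (hankel_kernel c \<alpha> s y) * \<phi> y)"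
      using True by (simp add: hankel_kernel_def \<phi>_def mult_ac)
    finally show ?thesis .
  qed (simp add: f_def)
  have bnd: "norm (f l y) \<le> (?K * (\<bar>bessel_coeff \<alpha> l\<bar> * ?z ^ (2 * l))) * (?I y * M)" for l y
  proof (cases "y \<in> {0<..<1}")
    case True
    have "?e l = (n - 1 + (k + 2 * l)) + k" using n by simp
    then have "norm (of_real (y ^ ?e l) * G (y\<^sup>2)) = y ^ (n - 1 + (k + 2 * l)) * norm (of_real (y ^ k) * G (y\<^sup>2))"
      using True by (simp only: power_add of_real_mult mult.assoc norm_mult) (simp add: norm_power)
    also have "\<dots> \<le> 1 * M"
      using True bound by (intro mult_mono power_le_one) auto
    finally have *: "norm (of_real (y ^ ?e l) * G (y\<^sup>2)) \<le> M" by simp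
    have "f l y = of_real (?K * (bessel_coeff \<alpha> l * ?z ^ (2 * l))) * (of_real (y ^ ?e l) * G (y\<^sup>2))"
      using True by (simp add: f_def)
    then have "norm (f l y) = \<bar>?K * (bessel_coeff \<alpha> l * ?z ^ (2 * l))\<bar> * norm (of_real (y ^ ?e l) * G (y\<^sup>2))"
      by (simp only: norm_mult norm_of_real)
    also have "\<dots> \<le> \<bar>?K * (bessel_coeff \<alpha> l * ?z ^ (2 * l))\<bar> * M"
      by (intro mult_left_mono *) simp
    also have "\<bar>?K * (bessel_coeff \<alpha> l * ?z ^ (2 * l))\<bar> = ?K * (\<bar>bessel_coeff \<alpha> l\<bar> * ?z ^ (2 * l))"
      using c s by (simp add: abs_mult)
    finally show ?thesis using True by simp
  qed (simp add: f_def)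
  have fmeas: "f l \<in> borel_measurable lborel" for l
  proof -
    have "f l = (\<lambda>y. of_real (?I y * (?K * (bessel_coeff \<alpha> l * ?z ^ (2 * l)) * y ^ ?e l)) * (indicator {0<..1} y *\<^sub>R G (y\<^sup>2)))"
      by (auto simp: f_def indicator_def fun_eq_iff)
    also have "\<dots> \<in> borel_measurable lborel"
      using meas by measurable
    finally show ?thesis .
  qed
  have Mint: "integrable lborel (\<lambda>y. ?I y * M)"
    by (intro integrable_mult_left integrable_real_indicator) auto
  have suma: "summable (\<lambda>l. ?K * (\<bar>bessel_coeff \<alpha> l\<bar> * ?z ^ (2 * l)))"
    by (intro summable_mult bessel_coeff_summable \<alpha>)
  have lim: "(\<Sum>l. f l y) = ?I y *\<^sub>R (of_real (hankel_kernel c \<alpha> s y) * \<phi> y)" for y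
    using fsum sums_unique by metis
  show "set_integrable lborel {0<..<1} (\<lambda>y. of_real (hankel_kernel c \<alpha> s y) * \<phi> y)"
    using sums_integral_dominated(1) [OF fmeas Mint suma bnd] unfolding lim set_integrable_def .
  have "(\<lambda>l. of_real (sqrt (2 * pi)) * integral\<^sup>L lborel (f l)) sums finite_hankel c \<alpha> \<phi> s"
    using sums_mult [OF sums_integral_dominated(2) [OF fmeas Mint suma bnd]]
    unfolding lim finite_hankel_def set_lebesgue_integral_def .
  moreover have "of_real (sqrt (2 * pi)) * integral\<^sup>L lborel (f l) =
      of_real (sqrt (2 * pi) * ?K * (bessel_coeff \<alpha> l * ?z ^ (2 * l))) *
          (LINT r:{0<..<1}|lborel. of_real (r ^ ?e l) * G (r\<^sup>2))" for l
    unfolding set_lebesgue_integral_def f_def integral_mult_right_zero [symmetric]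
    by (rule Bochner_Integration.integral_cong) (simp_all add: mult_ac)
  ultimately show "(\<lambda>l. of_real (sqrt (2 * pi) * sqrt (2 * pi * c * s) * ?z powr \<alpha> * (bessel_coeff \<alpha> l * ?z ^ (2 * l))) *
          (LINT r:{0<..<1}|lborel. of_real (r ^ ?e l) * G (r\<^sup>2)))
       sums finite_hankel c \<alpha> \<phi> s"
    by (simp add: mult.assoc)
qed

section \<open>From Fourier to Hankel eigenfunctions\<close>

lemma hankel_constant:
  fixes n k :: nat
  assumes "c > 0" "s > 0"
  shows "sqrt (2 * pi) * sqrt (2 * pi * c * s) * (pi * c * s) powr (real k + real n / 2 - 1)
    = 2 * pi powr (real n / 2) * (pi * c) ^ k * (c powr ((real n - 1) / 2) * s powr (real k + (real n - 1) / 2))"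
proof -
  let ?a = "real k + real n / 2 - 1"
  have "sqrt (2 * pi) * sqrt (2 * pi * c * s) = sqrt ((2 * pi)\<^sup>2 * (c * s))"
    by (simp only: real_sqrt_mult [symmetric] power2_eq_square mult_ac)
  also have "\<dots> = 2 * pi * (c powr (1 / 2) * s powr (1 / 2))"
    using assms by (simp only: real_sqrt_mult real_sqrt_abs powr_half_sqrt less_imp_le) simp
  finally have root: "sqrt (2 * pi) * sqrt (2 * pi * c * s) = \<dots>" .
  have p: "pi * pi powr ?a = pi powr (real n / 2) * pi ^ k"
  proof -
    have "pi * pi powr ?a = pi powr 1 * pi powr ?a"
      by simp
    also have "\<dots> = pi powr (real n / 2) * pi powr real k"
      by (simp only: powr_add [symmetric]) (simp add: algebra_simps)
    finally show ?thesis by (simp add: powr_realpow)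
  qed
  have q: "c powr (1 / 2) * c powr ?a = c ^ k * c powr ((real n - 1) / 2)"
  proof -
    have "c powr (1 / 2) * c powr ?a = c powr real k * c powr ((real n - 1) / 2)"
      by (simp only: powr_add [symmetric]) (simp add: field_simps)
    then show ?thesis using assms by (simp add: powr_realpow)
  qed
  have r: "s powr (1 / 2) * s powr ?a = s powr (real k + (real n - 1) / 2)"
    by (simp only: powr_add [symmetric]) (simp add: field_simps)
  have "sqrt (2 * pi) * sqrt (2 * pi * c * s) * (pi * c * s) powr ?a
      = 2 * (pi * pi powr ?a) * (c powr (1 / 2) * c powr ?a) * (s powr (1 / 2) * s powr ?a)"
    unfolding root using assms by (simp add: powr_mult)
  then show ?thesis
    unfolding p q r by (simp add: power_mult_distrib)
qed

lemma continuous_AE_zero: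
  fixes f :: "real \<Rightarrow> complex"
  assumes cont: "continuous_on {0..1} f" and AE: "AE r\<in>{0<..<1} in lborel. f r = 0"
    and r: "r \<in> {0..1}"
  shows "f r = 0"
proof -
  have cn: "continuous_on {0..1} (\<lambda>r. norm (f r))"
    by (intro continuous_intros cont)
  have int: "set_integrable lborel {0..1} (\<lambda>r. norm (f r))"
    unfolding set_integrable_def using cn by (intro borel_integrable_compact) auto
  have "(LINT r:{0..1}|lborel. norm (f r)) = 0"
    unfolding set_lebesgue_integral_def
  proof (rule integral_eq_zero_AE)
    show "AE r in lborel. indicat_real {0..1} r *\<^sub>R norm (f r) = 0"
      using AE AE_lborel_singleton [of "0::real"] AE_lborel_singleton [of "1::real"]
      by eventually_elim (auto simp: indicator_def)
  qed
  with set_borel_integral_eq_integral [OF int]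
  have "((\<lambda>r. norm (f r)) has_integral 0) {0..1}"
    by (simp add: has_integral_integral)
  then have "norm (f r) = 0"
    using cn r by (intro has_integral_0_cbox_imp_0 [of 0 1 "\<lambda>r. norm (f r)"]) auto
  then show ?thesis by simp
qed

text \<open>
  If the only point at hand is the origin, then \<open>k = 0\<close> and \<open>H\<close> is constant, so any direction
  will do.
\<close>

lemma homogeneous_nonzero_direction:
  fixes H :: "'a::euclidean_space \<Rightarrow> complex"
  assumes H: "polyfn H" "pos_homogeneous k H" and x: "x \<in> cball 0 1" "H x \<noteq> 0"
  obtains \<omega> r where "norm \<omega> = 1" "H \<omega> \<noteq> 0" "r \<in> {0..1}" "x = r *\<^sub>R \<omega>"
proof (cases "x = 0")
  case True
  have "H x = 2 ^ k *\<^sub>R H x"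
    using pos_homogeneousD [OF H(2), of 2 x] True by simp
  then have "(2 ^ k) *\<^sub>R H x = 1 *\<^sub>R H x" by (simp only: scaleR_one)
  then have "(2::real) ^ k = 1" using x(2) by (simp only: scaleR_cancel_right) simp
  then have "k = 0" using one_less_power [of "2::real" k] by (cases "k = 0") auto
  then have "H (SOME b. b \<in> Basis) = H x"
    using homogeneous_0_const [OF H(1)] H(2) by metis
  then show ?thesis
    using True x by (intro that [of "SOME b. b \<in> Basis" 0]) (auto simp: SOME_Basis)
next
  case False
  have eq: "norm x *\<^sub>R (x /\<^sub>R norm x) = x" using False by simp
  have "H x = norm x ^ k *\<^sub>R H (x /\<^sub>R norm x)"
    using pos_homogeneousD [OF H(2), of "norm x" "x /\<^sub>R norm x"] False unfolding eq by simp
  then show ?thesis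
    using False x by (intro that [of "x /\<^sub>R norm x" "norm x"]) auto
qed

text \<open>
  The term of index \<open>k + 2 l\<close> in the Fourier series is, up to the factor that appears in the Hankel
  eigenvalue, the \<open>l\<close>-th term of the Hankel series: the factorials \<open>(k + 2 l)!\<close> and the powers
  of two cancel, \<open>\<i>\<^bsup>2 l\<^esup>\<close> becomes the alternating sign, and \<open>\<i>\<^sup>k\<close> is
  cancelled by \<open>(- \<i>)\<^sup>k\<close>.
\<close>

lemma bessel_series_term:
  fixes n k :: nat
  assumes "c > 0" "s > 0"
  shows "(2 * of_real pi * \<i> * of_real c) ^ (k + 2 * l) / fact (k + 2 * l) *
      complex_of_real (2 * pi powr (real n / 2) * moment_coeff (s\<^sup>2) k (k + 2 * l) * rGamma (real (n + (k + (k + 2 * l))) / 2))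
      * ((- \<i>) ^ k * of_real (c powr ((real n - 1) / 2) * s powr (real k + (real n - 1) / 2)))
    = of_real (sqrt (2 * pi) * sqrt (2 * pi * c * s) * (pi * c * s) powr (real k + real n / 2 - 1)
        * (bessel_coeff (real k + real n / 2 - 1) l * (pi * c * s) ^ (2 * l)))"
proof -
  let ?C = "c powr ((real n - 1) / 2) * s powr (real k + (real n - 1) / 2)"
  let ?R = "rGamma (real l + (real k + real n / 2 - 1) + 1)"
  have R: "rGamma (real (n + (k + (k + 2 * l))) / 2) = ?R"
    by (rule arg_cong [where f = rGamma]) (simp add: field_simps)
  have "2 * complex_of_real pi * \<i> * of_real c = \<i> * of_real (2 * (pi * c))"
    by simp
  then have "(2 * of_real pi * \<i> * of_real c) ^ (k + 2 * l) =
      \<i> ^ k * (\<i> ^ 2) ^ l * of_real ((2 * (pi * c)) ^ (k + 2 * l))"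
    by (simp only: power_mult_distrib [of \<i>] power_add [of \<i>] power_mult [of \<i>] of_real_power)
  then have w: "(2 * of_real pi * \<i> * of_real c) ^ (k + 2 * l) =
      \<i> ^ k * of_real ((- 1) ^ l * (2 ^ (k + 2 * l) * (pi * c) ^ (k + 2 * l)))"
    by (simp add: power_mult_distrib)
  have i: "\<i> ^ k * (- \<i>) ^ k = 1"
    by (simp flip: power_mult_distrib)
  have m: "moment_coeff (s\<^sup>2) k (k + 2 * l) = fact (k + 2 * l) / (2 ^ (k + 2 * l) * fact l) * s ^ (2 * l)"
    by (simp add: moment_coeff_eq power_mult)
  have "(2 * of_real pi * \<i> * of_real c) ^ (k + 2 * l) / fact (k + 2 * l) *
      complex_of_real (2 * pi powr (real n / 2) * moment_coeff (s\<^sup>2) k (k + 2 * l) * ?R)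
      * ((- \<i>) ^ k * of_real ?C)
    = (\<i> ^ k * (- \<i>) ^ k) * (of_real ((- 1) ^ l * (2 ^ (k + 2 * l) * (pi * c) ^ (k + 2 * l))) / of_real (fact (k + 2 * l)) *
      of_real (2 * pi powr (real n / 2) * moment_coeff (s\<^sup>2) k (k + 2 * l) * ?R) * of_real ?C)"
    unfolding w by simp
  also have "\<dots> = of_real ((- 1) ^ l * (2 ^ (k + 2 * l) * (pi * c) ^ (k + 2 * l)) / fact (k + 2 * l) *
      (2 * pi powr (real n / 2) * moment_coeff (s\<^sup>2) k (k + 2 * l) * ?R) * ?C)"
    unfolding i by (simp only: of_real_mult of_real_divide mult_1)
  also have "(- 1) ^ l * (2 ^ (k + 2 * l) * (pi * c) ^ (k + 2 * l)) / fact (k + 2 * l) *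
      (2 * pi powr (real n / 2) * moment_coeff (s\<^sup>2) k (k + 2 * l) * ?R) * ?C
    = 2 * pi powr (real n / 2) * (pi * c) ^ k * ?C * ((- 1) ^ l / fact l * ?R * (pi * c * s) ^ (2 * l))"
    unfolding m power_add [of "pi * c"] power_mult_distrib [of "pi * c" s]
    by (simp add: field_simps)
  also have "\<dots> = sqrt (2 * pi) * sqrt (2 * pi * c * s) * (pi * c * s) powr (real k + real n / 2 - 1)
        * (bessel_coeff (real k + real n / 2 - 1) l * (pi * c * s) ^ (2 * l))"
    unfolding hankel_constant [OF assms] bessel_coeff_def ..
  finally show ?thesis unfolding R .
qed

text \<open>
  On a ray \<open>s \<omega>\<close> with \<open>H \<omega> \<noteq> 0\<close> the value of the Fourier transform is the
  moment series times \<open>H (s \<omega>)\<close>. Cancelling that factor leaves a series in \<open>s\<close> which is,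
  term by term, the series of the Hankel transform.
\<close>

lemma hankel_eigenfunction_of_harmonic:
  fixes H :: "'a::euclidean_space \<Rightarrow> complex" and G :: "real \<Rightarrow> complex"
  assumes c: "c > 0"
    and H: "polyfn H" "pos_homogeneous k H" "\<And>x. laplacian H x = 0"
    and cont: "continuous_on (cball 0 1) (\<lambda>y. G ((norm y)\<^sup>2) * H y)"
    and nz: "x0 \<in> cball 0 1" "G ((norm x0)\<^sup>2) * H x0 \<noteq> 0"
    and eig: "\<And>x. x \<in> cball 0 1 \<Longrightarrow>
      (LINT y:cball 0 1|lborel. exp (2 * of_real pi * \<i> * of_real (c * (x \<bullet> y))) * (G ((norm y)\<^sup>2) * H y))
        = \<mu> * (G ((norm x)\<^sup>2) * H x)"
  shows "hankel_eigenfunction c (real k + real DIM('a) / 2 - 1)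
    (\<lambda>r. of_real (r powr (real k + (real DIM('a) - 1) / 2)) * G (r\<^sup>2))
    ((- \<i>) ^ k * of_real (c powr ((real DIM('a) - 1) / 2)) * \<mu>)"
proof -
  let ?n = "DIM('a)"
  let ?\<alpha> = "real k + real ?n / 2 - 1"
  let ?\<phi> = "\<lambda>r. of_real (r powr (real k + (real ?n - 1) / 2)) * G (r\<^sup>2) :: complex"
  let ?\<gamma> = "(- \<i>) ^ k * of_real (c powr ((real ?n - 1) / 2)) * \<mu>"
  obtain \<omega> r0 where \<omega>: "norm \<omega> = 1" "H \<omega> \<noteq> 0" and r0: "r0 \<in> {0..1}" "x0 = r0 *\<^sub>R \<omega>"
    using homogeneous_nonzero_direction [OF H(1,2) nz(1)] nz(2) by (metis mult_zero_right)
  \<comment> \<open>\<open>q r = r\<^sup>k G(r\<^sup>2)\<close> is the profile in a form that extends continuously to \<open>r = 0\<close>\<close>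
  define q where "q r = G (r\<^sup>2) * H (r *\<^sub>R \<omega>) / H \<omega>" for r
  have q: "q r = of_real (r ^ k) * G (r\<^sup>2)" if "r > 0" for r
    using that \<omega> by (simp add: q_def pos_homogeneousD [OF H(2)] scaleR_conv_of_real)
  have contq: "continuous_on {0..1} q"
  proof -
    have "continuous_on {0..1} (\<lambda>r. G ((norm (r *\<^sub>R \<omega>))\<^sup>2) * H (r *\<^sub>R \<omega>))"
      by (rule continuous_on_compose2 [OF cont]) (auto intro!: continuous_intros simp: \<omega>)
    then have "continuous_on {0..1} (\<lambda>r. G ((norm (r *\<^sub>R \<omega>))\<^sup>2) * H (r *\<^sub>R \<omega>) / H \<omega>)"
      by (rule continuous_on_divide) (auto simp: \<omega>)
    then show ?thesis by (simp add: q_def [abs_def] \<omega>)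
  qed
  have meas: "(\<lambda>r. indicator {0<..1} r *\<^sub>R G (r\<^sup>2)) \<in> borel_measurable borel"
  proof -
    have [measurable]: "(\<lambda>r. indicator {0..1} r *\<^sub>R q r) \<in> borel_measurable borel"
      using contq by (intro borel_measurable_continuous_on_indicator) auto
    have "(\<lambda>r. indicator {0<..1} r *\<^sub>R G (r\<^sup>2)) =
        (\<lambda>r. of_real (indicator {0<..1} r * inverse (r ^ k)) * (indicator {0..1} r *\<^sub>R q r))"
      by (auto simp: indicator_def q fun_eq_iff)
    also have "\<dots> \<in> borel_measurable borel" by measurable
    finally show ?thesis .
  qed
  have "bounded (q ` {0..1})"
    by (intro compact_imp_bounded compact_continuous_image contq compact_Icc)
  then obtain M where M: "\<And>r. r \<in> {0..1} \<Longrightarrow> norm (q r) \<le> M"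
    unfolding bounded_iff by blast
  have bound: "norm (of_real (r ^ k) * G (r\<^sup>2)) \<le> M" if "0 < r" "r < 1" for r
    using M [of r] that by (simp only: q [symmetric]) simp
  have "finite_hankel c ?\<alpha> ?\<phi> s = ?\<gamma> * ?\<phi> s" if s: "0 < s" "s < 1" for s
  proof -
    let ?x = "s *\<^sub>R \<omega>"
    let ?w = "2 * of_real pi * \<i> * of_real c :: complex"
    let ?A = "\<lambda>j. LINT r:{0<..<1}|lborel. of_real (r ^ (?n + (k + j) - 1)) * G (r\<^sup>2)"
    let ?T = "\<lambda>j. ?w ^ j / fact j *
      of_real (2 * pi powr (real ?n / 2) * moment_coeff (s\<^sup>2) k j * rGamma (real (?n + (k + j)) / 2)) * ?A j"
    \<comment> \<open>the Hankel eigenvalue without \<open>\<mu>\<close>, times the power of \<open>s\<close> in the eigenfunction\<close>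
    let ?d = "(- \<i>) ^ k * of_real (c powr ((real ?n - 1) / 2) * s powr (real k + (real ?n - 1) / 2)) :: complex"
    have nx: "norm ?x = s" "?x \<in> cball 0 1" using s \<omega> by auto
    have xx: "?x \<bullet> ?x = s\<^sup>2" using nx by (simp only: dot_square_norm)
    have Hx: "H ?x \<noteq> 0" using \<omega> s by (simp add: pos_homogeneousD [OF H(2)])
    have "(\<lambda>j. ?w ^ j / fact j * (LINT y:cball 0 1|lborel. (y \<bullet> ?x) ^ j *\<^sub>R (G ((norm y)\<^sup>2) * H y)))
      sums (\<mu> * (G (s\<^sup>2) * H ?x))"
      using fourier_moment_series [OF cont, of c ?x] eig [OF nx(2)] unfolding nx(1) by simp
    then have "(\<lambda>j. ?T j * H ?x) sums (\<mu> * G (s\<^sup>2) * H ?x)"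
      unfolding cball_moment_polar [OF H(1,2) cont meas] sphere_integral_harmonic [OF H] xx
      by (simp only: mult_ac)
    then have "(\<lambda>j. ?T j * H ?x / H ?x) sums (\<mu> * G (s\<^sup>2) * H ?x / H ?x)"
      by (rule sums_divide)
    then have "?T sums (\<mu> * G (s\<^sup>2))"
      unfolding nonzero_mult_div_cancel_right [OF Hx] .
    moreover have "strict_mono (\<lambda>l. k + 2 * l)"
      by (rule strict_monoI) simp
    moreover have "?T j = 0" if "j \<notin> range (\<lambda>l. k + 2 * l)" for j
    proof -
      have "moment_coeff (s\<^sup>2) k j = 0" using that by (intro moment_coeff_eq_0) auto
      then show ?thesis by simp
    qed
    ultimately have "(\<lambda>l. ?T (k + 2 * l)) sums (\<mu> * G (s\<^sup>2))"
      using sums_mono_reindex [of "\<lambda>l. k + 2 * l" ?T] by blast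
    then have "(\<lambda>l. ?T (k + 2 * l) * ?d) sums (\<mu> * G (s\<^sup>2) * ?d)"
      by (rule sums_mult2)
    moreover have "?T (k + 2 * l) * ?d = of_real (sqrt (2 * pi) * sqrt (2 * pi * c * s) * (pi * c * s) powr ?\<alpha>
        * (bessel_coeff ?\<alpha> l * (pi * c * s) ^ (2 * l))) * ?A (k + 2 * l)" for l
      unfolding bessel_series_term [OF c s(1), symmetric] by (simp only: mult_ac)
    ultimately have "(\<lambda>l. of_real (sqrt (2 * pi) * sqrt (2 * pi * c * s) * (pi * c * s) powr ?\<alpha>
        * (bessel_coeff ?\<alpha> l * (pi * c * s) ^ (2 * l))) * ?A (k + 2 * l)) sums (\<mu> * G (s\<^sup>2) * ?d)"
      by (simp only:)
    then have "finite_hankel c ?\<alpha> ?\<phi> s = \<mu> * G (s\<^sup>2) * ?d"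
      using hankel_transform_series(2) [OF c s(1) DIM_positive meas bound] by (rule sums_unique2 [symmetric])
    then show ?thesis by (simp add: mult_ac)
  qed
  moreover have "set_integrable lborel {0<..<1} (\<lambda>y. of_real (hankel_kernel c ?\<alpha> s y) * ?\<phi> y)" if "0 < s" for s
    by (rule hankel_transform_series(1) [OF c that DIM_positive meas bound])
  moreover have "\<not> (AE r\<in>{0<..<1} in lborel. ?\<phi> r = 0)"
  proof
    assume "AE r\<in>{0<..<1} in lborel. ?\<phi> r = 0"
    then have "AE r\<in>{0<..<1} in lborel. q r = 0"
      by eventually_elim (auto simp: q)
    then have "q r0 = 0"
      using contq r0(1) by (intro continuous_AE_zero) auto
    then show False
      using nz(2) \<omega> r0 by (simp add: q_def)
  qed
  ultimately show ?thesis
    by (auto simp: hankel_eigenfunction_def)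
qed

section \<open>Harmonicity of spherical monogenics and of their products with the vector variable\<close>

lemma cliff_mult_scaleR_right: "u \<odot> (r *\<^sub>R v) = r *\<^sub>R (u \<odot> v)"
proof -
  have *: "r *\<^sub>R w = of_real r *s w" for w :: "'a clifford"
    by (simp add: vec_eq_iff scaleR_conv_of_real[where 'a = complex])
  show ?thesis unfolding * by (rule cliff_mult_scale_right)
qed

lemma cliff_mult_scaleR_left: "(r *\<^sub>R u) \<odot> v = r *\<^sub>R (u \<odot> v)"
proof -
  have *: "r *\<^sub>R w = of_real r *s w" for w :: "'a clifford"
    by (simp add: vec_eq_iff scaleR_conv_of_real[where 'a = complex])
  show ?thesis unfolding * by (rule cliff_mult_scale_left)
qed

lemma bounded_linear_cliff_mult: "bounded_linear (\<lambda>v. u \<odot> v)"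
  unfolding linear_conv_bounded_linear [symmetric]
  by (rule linearI) (simp_all add: cliff_mult_add_right cliff_mult_scaleR_right)

lemma sum_Basis_axis:
  fixes g :: "real ^ 'n \<Rightarrow> 'b::comm_monoid_add"
  shows "(\<Sum>b\<in>Basis. g b) = (\<Sum>j\<in>UNIV. g (axis j 1))"
proof -
  have basis: "(Basis :: (real ^ 'n) set) = range (\<lambda>j. axis j 1)"
    by (auto simp: Basis_vec_def)
  have inj: "inj (\<lambda>j::'n. axis j (1::real))"
    by (auto simp: inj_on_def axis_eq_axis)
  show ?thesis unfolding basis by (subst sum.reindex [OF inj]) simp
qed

lemma dirac_pd: "dirac_on UNIV f x = (\<Sum>j\<in>UNIV. gen j \<odot> pd (axis j 1) f x)"
  by (simp add: dirac_on_def pd_def)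

lemma laplacian_vec:
  fixes f :: "real ^ 'n \<Rightarrow> 'b::real_normed_vector"
  shows "laplacian f x = (\<Sum>j\<in>UNIV. pd (axis j 1) (pd (axis j 1) f) x)"
  unfolding laplacian_def by (rule sum_Basis_axis)

lemma gen_clifford: "gen i \<odot> gen j + gen j \<odot> gen i = (if i = j then - 2 *\<^sub>R blade {} else 0)"
  using gen_square [of i] gen_anticommute [of i j] by (auto simp: scaleR_2)

text \<open>
  Second derivatives commute, so only the symmetric part of \<open>e\<^sub>i e\<^sub>j\<close> contributes, and this
  is \<open>- \<delta>\<^bsub>ij\<^esub>\<close>.
\<close>

lemma dirac_square:
  fixes f :: "real ^ 'n::{finite,linorder} \<Rightarrow> 'n clifford"
  assumes f: "polyfn f"
  shows "dirac_on UNIV (dirac_on UNIV f) x = - laplacian f x"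
proof -
  let ?D = "\<lambda>i j. pd (axis i 1) (pd (axis j 1) f) x"
  have sym: "?D i j = ?D j i" for i j
    using pd_commute [OF f] by metis
  have "dirac_on UNIV (dirac_on UNIV f) x = (\<Sum>i\<in>UNIV. gen i \<odot> pd (axis i 1) (\<lambda>x. \<Sum>j\<in>UNIV. gen j \<odot> pd (axis j 1) f x) x)"
    unfolding dirac_pd [abs_def] ..
  also have "\<dots> = (\<Sum>i\<in>UNIV. \<Sum>j\<in>UNIV. (gen i \<odot> gen j) \<odot> ?D i j)"
    by (simp add: pd_sum polyfn_bounded_linear [OF bounded_linear_cliff_mult] polyfn_pd f
        pd_bounded_linear [OF bounded_linear_cliff_mult] cliff_mult_sum_right cliff_mult_assoc)
  finally have D: "dirac_on UNIV (dirac_on UNIV f) x = (\<Sum>i\<in>UNIV. \<Sum>j\<in>UNIV. (gen i \<odot> gen j) \<odot> ?D i j)" .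
  also have "\<dots> = (\<Sum>j\<in>UNIV. \<Sum>i\<in>UNIV. (gen i \<odot> gen j) \<odot> ?D j i)"
    by (subst sum.swap) (simp only: sym)
  finally have "2 *\<^sub>R dirac_on UNIV (dirac_on UNIV f) x
      = (\<Sum>i\<in>UNIV. \<Sum>j\<in>UNIV. (gen i \<odot> gen j + gen j \<odot> gen i) \<odot> ?D i j)"
    unfolding scaleR_2 cliff_mult_add_left sum.distrib D [symmetric] by simp
  also have "\<dots> = (\<Sum>i\<in>UNIV. \<Sum>j\<in>UNIV. if i = j then - 2 *\<^sub>R ?D i j else 0)"
    unfolding gen_clifford by (intro sum.cong refl) (simp add: cliff_mult_scaleR_left cliff_one_left del: scaleR_minus_left)
  also have "\<dots> = 2 *\<^sub>R (- laplacian f x)"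
    by (simp add: laplacian_vec scaleR_sum_right sum_negf)
  finally show ?thesis by (simp del: scaleR_minus_right)
qed

lemma monogenic_harmonic:
  fixes Y :: "real ^ 'n::{finite,linorder} \<Rightarrow> 'n clifford"
  assumes "polyfn Y" "\<And>x. dirac_on UNIV Y x = 0"
  shows "laplacian Y x = 0"
proof -
  have "dirac_on UNIV Y = (\<lambda>_. 0)" using assms(2) by auto
  then have "- laplacian Y x = dirac_on UNIV (\<lambda>_. 0) x"
    using dirac_square [OF assms(1), of x] by simp
  also have "\<dots> = 0" by (simp add: dirac_pd)
  finally show ?thesis by simp
qed

lemma cliff_vec_mult: "cliff_vec x \<odot> u = (\<Sum>j\<in>UNIV. (x \<bullet> axis j 1) *\<^sub>R (gen j \<odot> u))"
  by (simp add: cliff_vec_def cliff_mult_sum_left cliff_mult_scaleR_left inner_axis)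

lemma polyfn_cliff_vec_mult:
  fixes Y :: "real ^ 'n::{finite,linorder} \<Rightarrow> 'n clifford"
  assumes "polyfn Y"
  shows "polyfn (\<lambda>x. cliff_vec x \<odot> Y x)"
  unfolding cliff_vec_mult
  by (intro polyfn_sum polyfn.times_inner polyfn_bounded_linear [OF bounded_linear_cliff_mult] assms)

lemma pd_cliff_vec_mult:
  fixes Y :: "real ^ 'n::{finite,linorder} \<Rightarrow> 'n clifford"
  assumes Y: "polyfn Y"
  shows "pd (axis i 1) (\<lambda>x. cliff_vec x \<odot> Y x) = (\<lambda>x. gen i \<odot> Y x + cliff_vec x \<odot> pd (axis i 1) Y x)"
proof
  fix x
  have g: "polyfn (\<lambda>x. gen j \<odot> Y x)" for j
    by (rule polyfn_bounded_linear [OF bounded_linear_cliff_mult Y])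
  have "pd (axis i 1) (\<lambda>x. cliff_vec x \<odot> Y x) x
    = (\<Sum>j\<in>UNIV. (axis i 1 \<bullet> axis j (1::real)) *\<^sub>R (gen j \<odot> Y x) + (x \<bullet> axis j 1) *\<^sub>R (gen j \<odot> pd (axis i 1) Y x))"
    unfolding cliff_vec_mult
    by (simp add: pd_sum polyfn.times_inner g pd_times_inner [OF g] pd_bounded_linear [OF bounded_linear_cliff_mult Y])
  also have "\<dots> = (\<Sum>j\<in>UNIV. (if i = j then 1 else 0) *\<^sub>R (gen j \<odot> Y x)) + cliff_vec x \<odot> pd (axis i 1) Y x"
    by (simp add: sum.distrib cliff_vec_mult inner_axis_axis cong: if_cong)
  also have "(\<Sum>j\<in>UNIV. (if i = j then 1 else 0) *\<^sub>R (gen j \<odot> Y x)) = gen i \<odot> Y x"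
    by (simp add: if_distrib [of "\<lambda>r. r *\<^sub>R _"] cong: if_cong)
  finally show "pd (axis i 1) (\<lambda>x. cliff_vec x \<odot> Y x) x = gen i \<odot> Y x + cliff_vec x \<odot> pd (axis i 1) Y x" .
qed

text \<open>
  Leibniz' rule: the vector variable is linear in \<open>x\<close>, so besides \<open>x \<Delta>Y\<close> only the mixed
  terms \<open>e\<^sub>i \<partial>\<^sub>i Y\<close> survive, each occurring twice.
\<close>

lemma laplacian_cliff_vec_mult:
  fixes Y :: "real ^ 'n::{finite,linorder} \<Rightarrow> 'n clifford"
  assumes Y: "polyfn Y"
  shows "laplacian (\<lambda>x. cliff_vec x \<odot> Y x) x = 2 *\<^sub>R dirac_on UNIV Y x + cliff_vec x \<odot> laplacian Y x"
proof -
  have "pd (axis i 1) (pd (axis i 1) (\<lambda>x. cliff_vec x \<odot> Y x)) x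
    = 2 *\<^sub>R (gen i \<odot> pd (axis i 1) Y x) + cliff_vec x \<odot> pd (axis i 1) (pd (axis i 1) Y) x" for i
    by (simp add: pd_cliff_vec_mult Y polyfn_pd pd_add polyfn_cliff_vec_mult
        polyfn_bounded_linear [OF bounded_linear_cliff_mult] pd_bounded_linear [OF bounded_linear_cliff_mult] scaleR_2)
  then show ?thesis
    by (simp add: laplacian_vec dirac_pd sum.distrib scaleR_sum_right cliff_mult_sum_right)
qed

lemma polyfn_monomial:
  fixes u :: "'b::real_normed_vector"
  shows "polyfn (\<lambda>x::real ^ 'n. (\<Prod>j\<in>J. (x $ j) ^ a j) *\<^sub>R u)"
proof (induction J rule: infinite_finite_induct)
  case (insert j J)
  have "polyfn (\<lambda>x. (x \<bullet> axis j 1) ^ a j *\<^sub>R ((\<Prod>j\<in>J. (x $ j) ^ a j) *\<^sub>R u))"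
    by (rule polyfn_power_inner [OF insert.IH])
  then show ?case using insert.hyps by (simp add: inner_axis)
qed (auto intro: polyfn.const)

lemma homogeneous_polynomial_polyfn:
  assumes "homogeneous_polynomial k Y"
  shows "polyfn Y" "pos_homogeneous k Y"
proof -
  obtain C where C: "\<And>x. Y x = (\<Sum>a | (\<Sum>j\<in>UNIV. a j) = k. (\<Prod>j\<in>UNIV. (x $ j) ^ a j) *\<^sub>R C a)"
    using assms unfolding homogeneous_polynomial_def by blast
  have "Y = (\<lambda>x. \<Sum>a | (\<Sum>j\<in>UNIV. a j) = k. (\<Prod>j\<in>UNIV. (x $ j) ^ a j) *\<^sub>R C a)"
    using C by auto
  then show "polyfn Y"
    by (simp only: polyfn_sum polyfn_monomial)
  show "pos_homogeneous k Y"
    unfolding pos_homogeneous_def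
  proof (intro allI impI)
    fix t :: real and x
    show "Y (t *\<^sub>R x) = t ^ k *\<^sub>R Y x"
      unfolding C scaleR_sum_right
      by (intro sum.cong refl) (auto simp: power_mult_distrib prod.distrib power_sum)
  qed
qed

lemma pos_homogeneous_cliff_vec_mult:
  assumes "pos_homogeneous k Y"
  shows "pos_homogeneous (k + 1) (\<lambda>x. cliff_vec x \<odot> Y x)"
  unfolding pos_homogeneous_def cliff_vec_mult
  by (auto simp: pos_homogeneousD [OF assms] cliff_mult_scaleR_right scaleR_sum_right mult_ac)

section \<open>The radial factors of the Clifford prolate spheroidal wave functions\<close>

text \<open>
  A coordinate in which \<open>\<psi>\<close> does not vanish identically yields a scalar eigenfunction of the finite
  Fourier transform with the same radial factor, since that transform acts coordinatewise.
\<close>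

lemma hankel_eigenfunction_of_clifford:
  fixes W \<psi> :: "real ^ 'n::{finite,linorder} \<Rightarrow> 'n clifford"
  assumes c: "c > 0"
    and W: "polyfn W" "pos_homogeneous k W" "\<And>x. laplacian W x = 0"
    and \<psi>: "cpswf c \<psi>" "\<And>x. x \<in> cball 0 1 \<Longrightarrow> \<psi> x = G ((norm x)\<^sup>2) *s W x"
    and eig: "\<And>x. x \<in> cball 0 1 \<Longrightarrow> finite_fourier c \<psi> x = \<mu> *s \<psi> x"
  shows "hankel_eigenfunction c (real k + real CARD('n) / 2 - 1)
    (\<lambda>r. of_real (r powr (real k + (real CARD('n) - 1) / 2)) * G (r\<^sup>2))
    ((- \<i>) ^ k * of_real (c powr ((real CARD('n) - 1) / 2)) * \<mu>)"
proof -
  have cont\<psi>: "continuous_on (cball 0 1) \<psi>"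
    using \<psi>(1) unfolding cpswf_def by (auto intro: differentiable_imp_continuous_on)
  obtain x0 where x0: "x0 \<in> cball 0 1" "\<psi> x0 \<noteq> 0"
    using \<psi>(1) unfolding cpswf_def by auto
  then obtain A where A: "\<psi> x0 $ A \<noteq> 0"
    by (auto simp: vec_eq_iff)
  define H where "H x = W x $ A" for x
  have \<psi>A: "\<psi> x $ A = G ((norm x)\<^sup>2) * H x" if "x \<in> cball 0 1" for x
    using \<psi>(2) [OF that] by (simp add: H_def)
  have bl: "bounded_linear (\<lambda>v::'n clifford. v $ A)"
    by (rule bounded_linear_vec_nth)
  have H: "polyfn H" "pos_homogeneous k H" "laplacian H x = 0" for x
  proof -
    show "polyfn H" unfolding H_def by (rule polyfn_bounded_linear [OF bl W(1)])
    show "pos_homogeneous k H"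
      using W(2) by (simp add: pos_homogeneous_def H_def)
    have "laplacian H x = laplacian W x $ A"
      unfolding laplacian_def H_def [abs_def]
      by (simp add: pd_bounded_linear [OF bl] W(1) polyfn_pd)
    then show "laplacian H x = 0" by (simp add: W(3))
  qed
  have cont: "continuous_on (cball 0 1) (\<lambda>y. G ((norm y)\<^sup>2) * H y)"
    using continuous_on_component [OF cont\<psi>, of A] by (rule continuous_on_cong [THEN iffD1, rotated -1]) (auto simp: \<psi>A)
  have "hankel_eigenfunction c (real k + real DIM(real ^ 'n::{finite,linorder}) / 2 - 1)
    (\<lambda>r. of_real (r powr (real k + (real DIM(real ^ 'n::{finite,linorder}) - 1) / 2)) * G (r\<^sup>2))
    ((- \<i>) ^ k * of_real (c powr ((real DIM(real ^ 'n::{finite,linorder}) - 1) / 2)) * \<mu>)"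
  proof (rule hankel_eigenfunction_of_harmonic [OF c H cont x0(1)])
    show "G ((norm x0)\<^sup>2) * H x0 \<noteq> 0"
      using A \<psi>A [OF x0(1)] by simp
    fix x :: "real ^ 'n::{finite,linorder}" assume x: "x \<in> cball 0 1"
    let ?e = "\<lambda>y. exp (2 * of_real pi * \<i> * of_real (c * (x \<bullet> y)))"
    have "continuous_on (cball 0 1) (\<lambda>y. ?e y *s \<psi> y)"
      unfolding vector_scalar_mult_def
      by (intro continuous_on_vec_lambda continuous_intros continuous_on_component cont\<psi>)
    then have "set_integrable lborel (cball 0 1) (\<lambda>y. ?e y *s \<psi> y)"
      by (rule set_integrable_cball)
    then have "finite_fourier c \<psi> x $ A = (LINT y:cball 0 1|lborel. (?e y *s \<psi> y) $ A)"
      unfolding finite_fourier_def set_lebesgue_integral_def set_integrable_def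
      by (subst integral_bounded_linear [OF bl, symmetric]) simp_all
    also have "\<dots> = (LINT y:cball 0 1|lborel. ?e y * (G ((norm y)\<^sup>2) * H y))"
      by (rule set_lebesgue_integral_cong) (auto simp: \<psi>A)
    finally show "(LINT y:cball 0 1|lborel. ?e y * (G ((norm y)\<^sup>2) * H y)) = \<mu> * (G ((norm x)\<^sup>2) * H x)"
      using eig [OF x] \<psi>A [OF x] by simp
  qed
  then show ?thesis by simp
qed

theorem proposition3p3:
  fixes c :: real and k :: nat
    and Y :: "real ^ 'n::{finite,linorder} \<Rightarrow> 'n clifford"
    and P Q :: "nat \<Rightarrow> real \<Rightarrow> complex"
    and \<psi> :: "nat \<Rightarrow> real ^ 'n::{finite,linorder} \<Rightarrow> 'n clifford"
    and \<mu> :: "nat \<Rightarrow> complex"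
  assumes "c > 0"
    and "spherical_monogenic k Y" and "\<exists>x. Y x \<noteq> 0"
    and "\<And>n. cpswf c (\<psi> n)"
    and "\<And>N x. x \<in> cball 0 1 \<Longrightarrow> \<psi> (2 * N) x = P N ((norm x)\<^sup>2) *s Y x"
    and "\<And>N x. x \<in> cball 0 1 \<Longrightarrow> \<psi> (2 * N + 1) x = Q N ((norm x)\<^sup>2) *s (cliff_vec x \<odot> Y x)"
    and "\<And>n x. x \<in> cball 0 1 \<Longrightarrow> finite_fourier c (\<psi> n) x = \<mu> n *s \<psi> n x"
  shows "\<forall>N.
      hankel_eigenfunction c (real k + real CARD('n) / 2 - 1)
        (\<lambda>r. of_real (r powr (real k + (real CARD('n) - 1) / 2)) * P N (r\<^sup>2))
        ((- \<i>) ^ k * of_real (c powr ((real CARD('n) - 1) / 2)) * \<mu> (2 * N))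
    \<and> hankel_eigenfunction c (real k + real CARD('n) / 2)
        (\<lambda>r. of_real (r powr (real k + (real CARD('n) + 1) / 2)) * Q N (r\<^sup>2))
        ((- \<i>) ^ (k + 1) * of_real (c powr ((real CARD('n) - 1) / 2)) * \<mu> (2 * N + 1))"
proof (intro allI conjI)
  fix N
  have Y: "polyfn Y" "pos_homogeneous k Y" "\<And>x. dirac_on UNIV Y x = 0"
    using assms(2) homogeneous_polynomial_polyfn by (auto simp: spherical_monogenic_def)
  have harm: "laplacian Y x = 0" for x
    by (rule monogenic_harmonic [OF Y(1,3)])
  show "hankel_eigenfunction c (real k + real CARD('n) / 2 - 1)
        (\<lambda>r. of_real (r powr (real k + (real CARD('n) - 1) / 2)) * P N (r\<^sup>2))
        ((- \<i>) ^ k * of_real (c powr ((real CARD('n) - 1) / 2)) * \<mu> (2 * N))"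
    by (rule hankel_eigenfunction_of_clifford [OF assms(1) Y(1,2) harm assms(4,5,7)])
  have "laplacian (\<lambda>x. cliff_vec x \<odot> Y x) x = 0" for x
    by (simp add: laplacian_cliff_vec_mult Y harm)
  note odd = hankel_eigenfunction_of_clifford [OF assms(1) polyfn_cliff_vec_mult [OF Y(1)]
      pos_homogeneous_cliff_vec_mult [OF Y(2)] this assms(4,6,7), of N]
  have "real (k + 1) + real CARD('n) / 2 - 1 = real k + real CARD('n) / 2"
    "real (k + 1) + (real CARD('n) - 1) / 2 = real k + (real CARD('n) + 1) / 2"
    by (simp_all add: field_simps)
  with odd show "hankel_eigenfunction c (real k + real CARD('n) / 2)
        (\<lambda>r. of_real (r powr (real k + (real CARD('n) + 1) / 2)) * Q N (r\<^sup>2))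
        ((- \<i>) ^ (k + 1) * of_real (c powr ((real CARD('n) - 1) / 2)) * \<mu> (2 * N + 1))"
    by (simp only:)
qed

end
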